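(* Let $\Phi$ be an admissible flux interpolation with constant $L_\Phi$, let $\mu\in\mathcal M^+(\mathbb R^d)$, $\rho^0\in\mathcal M_{TV}^M(\mathbb R^d)$ and $\eta^0\in C_b(\mathbb R^{2d}_{/})$. Let $V:[0,T]\times\mathcal M_{TV}^M(\mathbb R^d)\times\mathbb R^{2d}_{/}\to\mathbb R$ be a velocity field (i.e. $V_t[\rho]\in\mathcal V^{\mathrm{as}}(\mathbb R^{2d}_{/})$ for all $t,\rho$) such that, for some constants $C_V>0$ and $L_V\ge 0$, $$\sup_{t\in[0,T]}\ \sup_{\rho\in\mathcal M_{TV}^M(\mathbb R^d)}\ \sup_{x\in\mathbb R^d}\int_{\mathbb R^d\setminus\{x\}}|V_t[\rho](x,y)|\,\mathrm d\mu(y)\le C_V,$$ and, for all $t\in[0,T]$ and all $\rho,\sigma\in\mathcal M_{TV}^M(\mathbb R^d)$, $$\sup_{x\in\mathbb R^d}\int_{\mathbb R^d\setminus\{x\}}|V_t[\rho](x,y)-V_t[\sigma](x,y)|\,\mathrm d\mu(y)\le L_V\|\rho-\sigma\|_{TV}.$$ Let $\omega:[0,T]\times\mathcal M_{TV}^M(\mathbb R^d)\times\mathbb R^{2d}_{/}\to\mathbb R$ satisfy: (1) for all $t$ and $\sigma$ the map $(x,y)\mapsto\omega_t[\sigma](x,y)$ is continuous on $\mathbb R^{2d}_{/}$, and for all $\sigma$ and $(x,y)$ the map $t\mapsto\omega_t[\sigma](x,y)$ belongs to $L^1([0,T])$; (2) there is a constant $L_\omega\ge0$ such that $\sup_{t\in[0,T]}\sup_{(x,y)\in\mathbb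 R^{2d}_{/}}|\omega_t[\sigma](x,y)-\omega_t[\rho](x,y)|\le L_\omega\|\sigma-\rho\|_{TV}$ for all $\rho,\sigma\in\mathcal M_{TV}^M(\mathbb R^d)$; (3) there is a constant $C_\omega>0$ such that $\sup_{t\in[0,T]}\sup_{\rho\in\mathcal M_{TV}^M(\mathbb R^d)}\sup_{(x,y)\in\mathbb R^{2d}_{/}}|\omega_t[\rho](x,y)|\le C_\omega$. Let $(\varepsilon_n)_{n\in\mathbb N}\subset(0,\infty)$ with $\varepsilon_n\to0^+$, and for each $n$ let $(\rho^n,\eta^n)$ be the solution on $[0,T]$ of $$\partial_t\rho^n_t=-\overline\nabla\cdot F^\Phi[\mu,\eta^n_t;\rho^n_t,V_t[\rho^n_t]],\qquad \partial_t\eta^n_t=\varepsilon_n(\omega_t[\rho^n_t]-\eta^n_t),\qquad \rho^n_0=\rho^0,\ \eta^n_0=\eta^0.$$ Then $$d_\infty\big((\rho^n,\eta^n),(\overline\rho,\eta^0)\big)\to0\quad\text{as }n\to\infty,$$ where $\eta^0$ is regarded as a curve constant in time and $\overline\rho$ is the solution on $[0,T]$ of $$\overline\rho_t+\int_0^t\overline\nabla\cdot F^\Phi[\mu,\eta^0;\overline\rho_s,V_s[\overline\rho_s]]\,\mathrm ds=\rho^0,$$ understood in duality with $C_0(\mathbb R^d)$.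
   Context: $d\in\mathbb N$, $T\in(0,\infty)$ and $M>0$ are fixed. $\mathbb R^{2d}_{/}:=\{(x,y)\in\mathbb R^d\times\mathbb R^d:x\neq y\}$. $\mathcal M(A)$ and $\mathcal M^+(A)$ denote the signed, respectively nonnegative, Radon measures on $A$. $\mathcal M_{TV}(\mathbb R^d)$ is the space of signed Radon measures on $\mathbb R^d$ with finite total variation, with norm $\|\sigma\|_{TV}=|\sigma|(\mathbb R^d)$, and $\mathcal M_{TV}^M(\mathbb R^d)=\{\rho\in\mathcal M_{TV}(\mathbb R^d):|\rho|(\mathbb R^d)\le M\}$. $C_0(\mathbb R^d)$ is the space of continuous functions vanishing at infinity; $C_b(\mathbb R^{2d}_{/})$ is the space of bounded continuous functions with the sup-norm $\|\cdot\|_\infty$. Subscript $t$ denotes time dependence. $\mathcal V^{\mathrm{as}}(\mathbb R^{2d}_{/})=\{v:\mathbb R^{2d}_{/}\to\mathbb R : v(x,y)=-v(y,x)\}$. Nonlocal gradient: $\overline\nabla\varphi(x,y)=\varphi(y)-\varphi(x)$. Nonlocal divergence of $\boldsymbol j\in\mathcal M(\mathbb R^{2d}_{/})$: $\int_{\mathbb R^d}\varphi\,\mathrm d\overline\nabla\cdot\boldsymbol j=-\frac12\iint_{\mathbb R^{2d}_{/}}\overline\nabla\varphi\,\mathrm d\boldsymbol j$ for $\varphi\in C_0(\mathbb R^d)$. Admissible flux interpolation: a measurable $\Phi:\mathbb R^3\to\mathbb R$ such that (i) $\Phi(0,0;v)=\Phi(a,b;0)=0$ for all $a,b,v\in\mathbb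 R$; (ii) for some $L_\Phi>0$ and all $a,b,c,d,v,w\in\mathbb R$: $|\Phi(a,b;w)-\Phi(a,b;v)|\le L_\Phi(|a|+|b|)|w-v|$ and $|\Phi(a,b;v)-\Phi(c,d;v)|\le L_\Phi(|a-c|+|b-d|)|v|$; (iii) $\Phi(\alpha a,\alpha b;w)=\alpha\Phi(a,b;w)$ for all $\alpha>0$, $(a,b,w)\in\mathbb R^3$. Admissible flux: for $\rho\in\mathcal M_{TV}(\mathbb R^d)$, $w\in\mathcal V^{\mathrm{as}}(\mathbb R^{2d}_{/})$, measurable $\eta:\mathbb R^{2d}_{/}\to\mathbb R$ and $\lambda\in\mathcal M^+(\mathbb R^{2d})$ with $\rho\otimes\mu,\mu\otimes\rho\ll\lambda$, the measure $F^\Phi[\mu,\eta;\rho,w]$ on $\mathbb R^{2d}_{/}$ is $$\mathrm dF^\Phi[\mu,\eta;\rho,w]=\Phi\Big(\tfrac{\mathrm d(\rho\otimes\mu)}{\mathrm d\lambda},\tfrac{\mathrm d(\mu\otimes\rho)}{\mathrm d\lambda};w\Big)\,\eta\,\mathrm d\lambda$$ (independent of the choice of $\lambda$ by one-homogeneity; e.g. $\lambda=|\rho|\otimes\mu+\mu\otimes|\rho|$). For a normed space $S$ and $B\subseteq S$, $AC([0,T];B)$ is the set of curves $\gamma:[0,T]\to B$ for which there is $m\in L^1([0,T])$ with $\|\gamma_t-\gamma_s\|_S\le\int_s^tm(r)\,\mathrm dr$ for $0\le s<t\le T$. Solution: given $\varepsilon>0$, a pair $(\rho,\eta):[0,T]\to\mathcal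 M_{TV}^M(\mathbb R^d)\times C_b(\mathbb R^{2d}_{/})$ is a solution of $\partial_t\rho_t=-\overline\nabla\cdot F^\Phi[\mu,\eta_t;\rho_t,V_t[\rho_t]]$, $\partial_t\eta_t=\varepsilon(\omega_t[\rho_t]-\eta_t)$ if, for every $\varphi\in C_0(\mathbb R^d)$: (i) $\rho\in AC([0,T];\mathcal M_{TV}^M(\mathbb R^d))$ (with respect to $\|\cdot\|_{TV}$) and $\eta\in AC([0,T];C_b(\mathbb R^{2d}_{/}))$; (ii) the maps $t\mapsto\langle\varphi,\overline\nabla\cdot F^\Phi[\mu,\eta_t;\rho_t,V_t[\rho_t]]\rangle$ and $t\mapsto\varepsilon(\omega_t[\rho_t]-\eta_t)$ belong to $L^1([0,T])$; (iii) for a.e. $t\in[0,T]$ and every $(x,y)\in\mathbb R^{2d}_{/}$, $$\int\varphi\,\mathrm d\rho_t=\int\varphi\,\mathrm d\rho_0+\frac12\int_0^t\iint_{\mathbb R^{2d}_{/}}\overline\nabla\varphi\,\mathrm dF^\Phi[\mu,\eta_s;\rho_s,V_s[\rho_s]]\,\mathrm ds,$$ $$\eta_t(x,y)=\eta_0(x,y)+\varepsilon\int_0^t(\omega_s[\rho_s](x,y)-\eta_s(x,y))\,\mathrm ds.$$ The equation for $\overline\rho\in AC([0,T];\mathcal M_{TV}^M(\mathbb R^d))$ is understood as the first integral identity with $\eta_s$ replaced by $\eta^0$ for all $s$. Metric: $d_\infty((\rho^1,\eta^1),(\rho^2,\eta^2))=\sup_{t\in[0,T]}\|\rho^1_t-\rho^2_t\|_{TV}+\sup_{t\in[0,T]}\|\eta^1_t-\eta^2_t\|_\infty$.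 *)

theory Defs
  imports "HOL-Analysis.Analysis"
begin

section \<open>Finite signed measures\<close>

text \<open>
  A finite signed measure on the sigma-algebra of a measure space \<open>N\<close> (only \<open>space N\<close> and
  \<open>sets N\<close> are used) is a real-valued countably additive set function.  It is extended by \<open>0\<close>
  outside \<open>sets N\<close>, so that equality of signed measures is equality of set functions.
\<close>

definition signed_measure :: "'a measure \<Rightarrow> ('a set \<Rightarrow> real) \<Rightarrow> bool" where
  "signed_measure N \<nu> \<longleftrightarrow>
     \<nu> {} = 0 \<and> (\<forall>A. A \<notin> sets N \<longrightarrow> \<nu> A = 0) \<and>
     (\<forall>A::nat \<Rightarrow> 'a set. range A \<subseteq> sets N \<longrightarrow> disjoint_family A \<longrightarrow>
        (\<lambda>i. \<nu> (A i)) sums \<nu> (\<Union>i. A i))"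

text \<open>
  The Jordan decomposition \<open>\<nu> = \<nu>\<^sup>+ - \<nu>\<^sup>-\<close>.  The set function below is countably additive on
  \<open>sets N\<close> whenever \<open>signed_measure N \<nu>\<close> holds, so \<open>measure_of\<close> does not degenerate.
\<close>

definition pos_var :: "'a measure \<Rightarrow> ('a set \<Rightarrow> real) \<Rightarrow> 'a measure" where
  "pos_var N \<nu> = measure_of (space N) (sets N)
     (\<lambda>A. SUP B\<in>{B \<in> sets N. B \<subseteq> A}. ennreal (\<nu> B))"

definition neg_var :: "'a measure \<Rightarrow> ('a set \<Rightarrow> real) \<Rightarrow> 'a measure" where
  "neg_var N \<nu> = pos_var N (\<lambda>A. - \<nu> A)"

definition measure_add :: "'a measure \<Rightarrow> 'a measure \<Rightarrow> 'a measure" where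
  "measure_add P Q = measure_of (space P) (sets P) (\<lambda>A. emeasure P A + emeasure Q A)"

definition variation :: "'a measure \<Rightarrow> ('a set \<Rightarrow> real) \<Rightarrow> 'a measure" where
  "variation N \<nu> = measure_add (pos_var N \<nu>) (neg_var N \<nu>)"

definition signed_integral :: "'a measure \<Rightarrow> ('a set \<Rightarrow> real) \<Rightarrow> ('a \<Rightarrow> real) \<Rightarrow> real" where
  "signed_integral N \<nu> f = integral\<^sup>L (pos_var N \<nu>) f - integral\<^sup>L (neg_var N \<nu>) f"

text \<open>Every finite Borel measure on \<open>\<real>\<^sup>d\<close> is Radon, so regularity need not be required.\<close>

definition M_TV :: "((real^'n) set \<Rightarrow> real) set" where
  "M_TV = {\<sigma>. signed_measure borel \<sigma> \<and> emeasure (variation borel \<sigma>) UNIV < \<infinity>}"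

definition tv_norm :: "((real^'n) set \<Rightarrow> real) \<Rightarrow> real" where
  "tv_norm \<sigma> = measure (variation borel \<sigma>) UNIV"

definition M_TV_le :: "real \<Rightarrow> ((real^'n) set \<Rightarrow> real) set" where
  "M_TV_le M = {\<sigma> \<in> M_TV. tv_norm \<sigma> \<le> M}"

text \<open>On \<open>\<real>\<^sup>d\<close>, nonnegative Borel measures finite on compact sets are automatically regular.\<close>

definition radon_measure :: "(real^'n) measure \<Rightarrow> bool" where
  "radon_measure \<mu> \<longleftrightarrow> sets \<mu> = sets borel \<and> (\<forall>K. compact K \<longrightarrow> emeasure \<mu> K < \<infinity>)"

section \<open>Off-diagonal functions and nonlocal calculus\<close>

text \<open>
  Functions on the off-diagonal set are total functions on the product whose values on the
  diagonal are never used.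
\<close>

definition offdiag :: "((real^'n) \<times> (real^'n)) set" where
  "offdiag = {(x, y). x \<noteq> y}"

abbreviation offdiag_borel :: "((real^'n) \<times> (real^'n)) measure" where
  "offdiag_borel \<equiv> restrict_space borel offdiag"

definition antisym_fields :: "((real^'n) \<times> (real^'n) \<Rightarrow> real) set" where
  "antisym_fields = {v. \<forall>x y. x \<noteq> y \<longrightarrow> v (x, y) = - v (y, x)}"

definition C_zero :: "((real^'n) \<Rightarrow> real) set" where
  "C_zero = {\<phi>. continuous_on UNIV \<phi> \<and> (\<phi> \<longlongrightarrow> 0) at_infinity}"

definition C_b_offdiag :: "((real^'n) \<times> (real^'n) \<Rightarrow> real) set" where
  "C_b_offdiag = {f. continuous_on offdiag f \<and> bounded (f ` offdiag)}"

definition sup_norm_offdiag :: "((real^'n) \<times> (real^'n) \<Rightarrow> real) \<Rightarrow> real" where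
  "sup_norm_offdiag f = (SUP z\<in>offdiag. \<bar>f z\<bar>)"

definition nl_grad :: "((real^'n) \<Rightarrow> real) \<Rightarrow> (real^'n) \<times> (real^'n) \<Rightarrow> real" where
  "nl_grad \<phi> = (\<lambda>(x, y). \<phi> y - \<phi> x)"

text \<open>The duality pairing of \<open>\<phi>\<close> with the nonlocal divergence of \<open>j\<close>.\<close>

definition nl_div_pairing ::
  "((real^'n) \<Rightarrow> real) \<Rightarrow> (((real^'n) \<times> (real^'n)) set \<Rightarrow> real) \<Rightarrow> real" where
  "nl_div_pairing \<phi> j = - (1/2) * signed_integral offdiag_borel j (nl_grad \<phi>)"

section \<open>Flux interpolation and flux\<close>

definition admissible_interp :: "real \<Rightarrow> (real \<Rightarrow> real \<Rightarrow> real \<Rightarrow> real) \<Rightarrow> bool" where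
  "admissible_interp L \<Phi> \<longleftrightarrow>
     (\<lambda>(a, b, v). \<Phi> a b v) \<in> borel_measurable borel \<and>
     (\<forall>v. \<Phi> 0 0 v = 0) \<and> (\<forall>a b. \<Phi> a b 0 = 0) \<and>
     L > 0 \<and>
     (\<forall>a b v w. \<bar>\<Phi> a b w - \<Phi> a b v\<bar> \<le> L * (\<bar>a\<bar> + \<bar>b\<bar>) * \<bar>w - v\<bar>) \<and>
     (\<forall>a b c d v. \<bar>\<Phi> a b v - \<Phi> c d v\<bar> \<le> L * (\<bar>a - c\<bar> + \<bar>b - d\<bar>) * \<bar>v\<bar>) \<and>
     (\<forall>\<alpha> a b w. \<alpha> > 0 \<longrightarrow> \<Phi> (\<alpha> * a) (\<alpha> * b) w = \<alpha> * \<Phi> a b w)"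

text \<open>
  The density with respect to \<open>\<Lambda>\<close> of the signed measure \<open>P - Q\<close>, for sigma-finite nonnegative
  \<open>P\<close> and \<open>Q\<close>.  It is applied to \<open>\<rho>\<^sup>+ \<otimes> \<mu> - \<rho>\<^sup>- \<otimes> \<mu> = \<rho> \<otimes> \<mu>\<close>, where \<open>\<rho>\<^sup>\<plusminus> \<otimes> \<mu>\<close> may both be infinite.
\<close>

definition diff_density :: "'a measure \<Rightarrow> 'a measure \<Rightarrow> 'a measure \<Rightarrow> 'a \<Rightarrow> real" where
  "diff_density \<Lambda> P Q z = enn2real (RN_deriv \<Lambda> P z) - enn2real (RN_deriv \<Lambda> Q z)"

definition flux_wrt ::
  "((real^'n) \<times> (real^'n)) measure \<Rightarrow> (real \<Rightarrow> real \<Rightarrow> real \<Rightarrow> real) \<Rightarrow> (real^'n) measure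
    \<Rightarrow> ((real^'n) \<times> (real^'n) \<Rightarrow> real) \<Rightarrow> ((real^'n) set \<Rightarrow> real)
    \<Rightarrow> ((real^'n) \<times> (real^'n) \<Rightarrow> real) \<Rightarrow> ((real^'n) \<times> (real^'n)) set \<Rightarrow> real" where
  "flux_wrt \<Lambda> \<Phi> \<mu> \<eta> \<rho> w A =
     (if A \<in> sets offdiag_borel then
        (LINT z:A|\<Lambda>.
           \<Phi> (diff_density \<Lambda> (pos_var borel \<rho> \<Otimes>\<^sub>M \<mu>) (neg_var borel \<rho> \<Otimes>\<^sub>M \<mu>) z)
             (diff_density \<Lambda> (\<mu> \<Otimes>\<^sub>M pos_var borel \<rho>) (\<mu> \<Otimes>\<^sub>M neg_var borel \<rho>) z)
             (w z) * \<eta> z)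
      else 0)"

text \<open>
  By one-homogeneity of \<open>\<Phi>\<close> the flux does not depend on the dominating measure; we take
  \<open>\<Lambda> = \<bar>\<rho>\<bar> \<otimes> \<mu> + \<mu> \<otimes> \<bar>\<rho>\<bar>\<close>.
\<close>

definition flux ::
  "(real \<Rightarrow> real \<Rightarrow> real \<Rightarrow> real) \<Rightarrow> (real^'n) measure
    \<Rightarrow> ((real^'n) \<times> (real^'n) \<Rightarrow> real) \<Rightarrow> ((real^'n) set \<Rightarrow> real)
    \<Rightarrow> ((real^'n) \<times> (real^'n) \<Rightarrow> real) \<Rightarrow> ((real^'n) \<times> (real^'n)) set \<Rightarrow> real" where
  "flux \<Phi> \<mu> \<eta> \<rho> w =
     flux_wrt (measure_add (variation borel \<rho> \<Otimes>\<^sub>M \<mu>) (\<mu> \<Otimes>\<^sub>M variation borel \<rho>)) \<Phi> \<mu> \<eta> \<rho> w"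

section \<open>Curves and solutions\<close>

text \<open>
  Absolutely continuous curves on \<open>[0,T]\<close> with values in a subset \<open>B\<close> of a space of real-valued
  functions (of sets, or of points) normed by \<open>nrm\<close>.
\<close>

definition AC_curve ::
  "(('i \<Rightarrow> real) \<Rightarrow> real) \<Rightarrow> ('i \<Rightarrow> real) set \<Rightarrow> real \<Rightarrow> (real \<Rightarrow> 'i \<Rightarrow> real) \<Rightarrow> bool" where
  "AC_curve nrm B T \<gamma> \<longleftrightarrow>
     (\<forall>t\<in>{0..T}. \<gamma> t \<in> B) \<and>
     (\<exists>m. set_integrable lebesgue {0..T} m \<and>
        (\<forall>s t. 0 \<le> s \<longrightarrow> s < t \<longrightarrow> t \<le> T \<longrightarrow>
           nrm (\<lambda>i. \<gamma> t i - \<gamma> s i) \<le> (LINT r:{s..t}|lebesgue. m r)))"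

definition is_solution ::
  "(real \<Rightarrow> real \<Rightarrow> real \<Rightarrow> real) \<Rightarrow> (real^'n) measure
    \<Rightarrow> (real \<Rightarrow> ((real^'n) set \<Rightarrow> real) \<Rightarrow> (real^'n) \<times> (real^'n) \<Rightarrow> real)
    \<Rightarrow> (real \<Rightarrow> ((real^'n) set \<Rightarrow> real) \<Rightarrow> (real^'n) \<times> (real^'n) \<Rightarrow> real)
    \<Rightarrow> real \<Rightarrow> real \<Rightarrow> real
    \<Rightarrow> (real \<Rightarrow> (real^'n) set \<Rightarrow> real) \<Rightarrow> (real \<Rightarrow> (real^'n) \<times> (real^'n) \<Rightarrow> real) \<Rightarrow> bool" where
  "is_solution \<Phi> \<mu> V \<omega> \<epsilon> T M \<rho> \<eta> \<longleftrightarrow>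
     AC_curve tv_norm (M_TV_le M) T \<rho> \<and>
     AC_curve sup_norm_offdiag C_b_offdiag T \<eta> \<and>
     (\<forall>z\<in>offdiag. set_integrable lebesgue {0..T} (\<lambda>t. \<epsilon> * (\<omega> t (\<rho> t) z - \<eta> t z))) \<and>
     (\<forall>\<phi>\<in>C_zero.
        set_integrable lebesgue {0..T}
          (\<lambda>t. nl_div_pairing \<phi> (flux \<Phi> \<mu> (\<eta> t) (\<rho> t) (V t (\<rho> t)))) \<and>
        (AE t\<in>{0..T} in lebesgue.
           signed_integral borel (\<rho> t) \<phi> = signed_integral borel (\<rho> 0) \<phi> +
             1/2 * (LINT s:{0..t}|lebesgue.
               signed_integral offdiag_borel
                 (flux \<Phi> \<mu> (\<eta> s) (\<rho> s) (V s (\<rho> s))) (nl_grad \<phi>)) \<and>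
           (\<forall>z\<in>offdiag. \<eta> t z = \<eta> 0 z +
             \<epsilon> * (LINT s:{0..t}|lebesgue. \<omega> s (\<rho> s) z - \<eta> s z))))"

definition is_frozen_solution ::
  "(real \<Rightarrow> real \<Rightarrow> real \<Rightarrow> real) \<Rightarrow> (real^'n) measure
    \<Rightarrow> (real \<Rightarrow> ((real^'n) set \<Rightarrow> real) \<Rightarrow> (real^'n) \<times> (real^'n) \<Rightarrow> real)
    \<Rightarrow> real \<Rightarrow> real \<Rightarrow> ((real^'n) \<times> (real^'n) \<Rightarrow> real) \<Rightarrow> ((real^'n) set \<Rightarrow> real)
    \<Rightarrow> (real \<Rightarrow> (real^'n) set \<Rightarrow> real) \<Rightarrow> bool" where
  "is_frozen_solution \<Phi> \<mu> V T M \<eta>0 \<rho>0 \<rho> \<longleftrightarrow>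
     AC_curve tv_norm (M_TV_le M) T \<rho> \<and> \<rho> 0 = \<rho>0 \<and>
     (\<forall>\<phi>\<in>C_zero.
        set_integrable lebesgue {0..T}
          (\<lambda>t. nl_div_pairing \<phi> (flux \<Phi> \<mu> \<eta>0 (\<rho> t) (V t (\<rho> t)))) \<and>
        (AE t\<in>{0..T} in lebesgue.
           signed_integral borel (\<rho> t) \<phi> = signed_integral borel \<rho>0 \<phi> +
             1/2 * (LINT s:{0..t}|lebesgue.
               signed_integral offdiag_borel
                 (flux \<Phi> \<mu> \<eta>0 (\<rho> s) (V s (\<rho> s))) (nl_grad \<phi>))))"

text \<open>
  The suprema are taken in \<open>ennreal\<close>, so that unboundedness would give \<open>\<infinity>\<close> and not an
  unspecified real.
\<close>

definition d_infty ::
  "real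
    \<Rightarrow> (real \<Rightarrow> (real^'n) set \<Rightarrow> real) \<times> (real \<Rightarrow> (real^'n) \<times> (real^'n) \<Rightarrow> real)
    \<Rightarrow> (real \<Rightarrow> (real^'n) set \<Rightarrow> real) \<times> (real \<Rightarrow> (real^'n) \<times> (real^'n) \<Rightarrow> real)
    \<Rightarrow> ennreal" where
  "d_infty T = (\<lambda>(\<rho>1, \<eta>1) (\<rho>2, \<eta>2).
     (SUP t\<in>{0..T}. ennreal (tv_norm (\<lambda>A. \<rho>1 t A - \<rho>2 t A))) +
     (SUP t\<in>{0..T}. ennreal (sup_norm_offdiag (\<lambda>z. \<eta>1 t z - \<eta>2 t z))))"

end

theory Submission
  imports Defs
begin

text \<open>
  On \<open>[0,T]\<close> the slow variable satisfies \<open>\<bar>\<eta>\<^sup>n - \<eta>\<^sup>0\<bar> = O(\<epsilon>\<^sub>n)\<close> uniformly: the supremum \<open>K\<close> of the left-hand side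
  is finite by absolute continuity, and the integral equation gives
  \<open>K \<le> \<epsilon>\<^sub>n T (C\<^sub>\<omega> + \<parallel>\<eta>\<^sup>0\<parallel> + K)\<close>, where the last term is absorbed once \<open>\<epsilon>\<^sub>n T \<le> 1/2\<close>.
  For the densities, write both fluxes with respect to one dominating measure, which is allowed by the
  one-homogeneity of \<open>\<Phi>\<close>.  The Lipschitz bounds on \<open>\<Phi>\<close> and \<open>V\<close> then show that the fluxes differ in
  total variation by at most a constant times \<open>\<parallel>\<eta>\<^sup>n - \<eta>\<^sup>0\<parallel> + \<parallel>\<rho>\<^sup>n\<^sub>s - \<rho>bar\<^sub>s\<parallel>\<close>.  Testing with \<open>C\<^sub>0\<close> functions
  bounded by 1 recovers the total variation norm, and a Gronwall argument in an exponentially weighted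
  supremum norm concludes.
\<close>

section \<open>Signed measures and total variation\<close>

text \<open>Two obstacles shape the proof. First, \<open>\<mu>\<close> is finite only on compact
  sets, so \<open>\<rho>\<^sup>+ \<otimes> \<mu>\<close> and
  \<open>\<rho>\<^sup>- \<otimes> \<mu>\<close> may both be infinite and their difference need not
  exist as a set function. Identities between Jordan parts are therefore kept in additive form, and
  subtraction happens only for Radon-Nikodym densities, which sigma-finiteness makes finite almost
  everywhere. The dominating measure shared by two fluxes also contains the base measure of the
  difference of the two curves: the difference of two densities is then the density of the
  difference, and its integral against \<open>V\<close> is controlled by the norm of the difference,
  not by the sum of the norms. The hypothesis on \<open>V\<close> integrates over the second
  variable only; antisymmetry carries it to the first, where \<open>\<mu> \<otimes> \<rho>\<close>
  needs it. Second, the integral equations hold for almost every time, with a null set that may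
  depend on the test function. Both sides are continuous in time for a fixed test function, so the
  null set is removed before the supremum over test functions is taken.\<close>

lemma signed_measure_empty: "signed_measure N \<nu> \<Longrightarrow> \<nu> {} = 0"
  by (simp add: signed_measure_def)

lemma signed_measure_sums:
  assumes "signed_measure N \<nu>" "range A \<subseteq> sets N" "disjoint_family A"
  shows "(\<lambda>i. \<nu> (A i)) sums \<nu> (\<Union>i::nat. A i)"
  using assms by (simp add: signed_measure_def)

lemma signed_measure_Un:
  assumes "signed_measure N \<nu>" "A \<in> sets N" "B \<in> sets N" "A \<inter> B = {}"
  shows "\<nu> (A \<union> B) = \<nu> A + \<nu> B"
proof -
  have "(\<lambda>i. \<nu> (binaryset A B i)) sums \<nu> (\<Union>i. binaryset A B i)"
    using assms by (intro signed_measure_sums)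
      (auto simp: binaryset_def disjoint_family_on_def range_binaryset_eq split: if_splits)
  moreover have "(\<lambda>i. \<nu> (binaryset A B i)) sums (\<nu> A + \<nu> B)"
    using assms by (intro binaryset_sums signed_measure_empty)
  ultimately show ?thesis
    by (simp add: UN_binaryset_eq sums_unique2)
qed

lemma signed_measure_minus:
  "signed_measure N \<nu> \<Longrightarrow> signed_measure N (\<lambda>A. - \<nu> A)"
  by (auto simp: signed_measure_def intro: sums_minus)

lemma signed_measure_diff:
  "signed_measure N \<nu> \<Longrightarrow> signed_measure N \<tau> \<Longrightarrow> signed_measure N (\<lambda>A. \<nu> A - \<tau> A)"
  unfolding signed_measure_def by (intro conjI allI impI sums_diff) simp_all

lemma sets_pos_var [simp, measurable_cong]: "sets (pos_var N \<nu>) = sets N"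
  and space_pos_var [simp]: "space (pos_var N \<nu>) = space N"
  by (auto simp: pos_var_def sets.space_closed sets.sigma_sets_eq)

lemma sets_neg_var [simp, measurable_cong]: "sets (neg_var N \<nu>) = sets N"
  and space_neg_var [simp]: "space (neg_var N \<nu>) = space N"
  by (auto simp: neg_var_def)

lemma sets_measure_add [simp, measurable_cong]: "sets (measure_add P Q) = sets P"
  and space_measure_add [simp]: "space (measure_add P Q) = space P"
  by (auto simp: measure_add_def sets.space_closed sets.sigma_sets_eq)

lemma sets_variation [simp, measurable_cong]: "sets (variation N \<nu>) = sets N"
  and space_variation [simp]: "space (variation N \<nu>) = space N"
  by (auto simp: variation_def)

text \<open>\<open>measure_of\<close> returns its set function only once that function is known to
  be countably additive. Superadditivity on disjoint sets comes from uniting competitors, the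
  reverse inequality from cutting a competitor \<open>B\<close> along the sets \<open>A i\<close>.
  All of it takes place in \<open>ennreal\<close>, where the supremum may be \<infinity>.\<close>

lemma emeasure_pos_var:
  assumes \<nu>: "signed_measure N \<nu>" and A: "A \<in> sets N"
  shows "emeasure (pos_var N \<nu>) A = (SUP B\<in>{B \<in> sets N. B \<subseteq> A}. ennreal (\<nu> B))"
proof -
  define s where "s A = (SUP B\<in>{B \<in> sets N. B \<subseteq> A}. ennreal (\<nu> B))" for A
  have upper: "ennreal (\<nu> B) \<le> s A" if "B \<in> sets N" "B \<subseteq> A" for A B
    unfolding s_def by (rule SUP_upper) (use that in auto)
  have least: "s A \<le> c" if "\<And>B. B \<in> sets N \<Longrightarrow> B \<subseteq> A \<Longrightarrow> ennreal (\<nu> B) \<le> c" for A c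
    unfolding s_def by (rule SUP_least) (use that in auto)
  have pos: "positive (sets N) s"
    using signed_measure_empty[OF \<nu>] by (auto simp: positive_def s_def intro!: antisym SUP_least)
  have add: "s A + s B \<le> s (A \<union> B)" if "A \<inter> B = {}" for A B
  proof -
    \<comment> \<open>\<open>ennreal\<close> sends negative reals to 0, so it is additive only on
      nonnegative values. If one of the two values is negative, its term vanishes and the other set
      alone is a competitor.\<close>
    have 1: "ennreal (\<nu> C) + ennreal (\<nu> D) \<le> s (A \<union> B)"
      if C: "C \<in> sets N" "C \<subseteq> A" and D: "D \<in> sets N" "D \<subseteq> B" for C D
    proof (cases "\<nu> C \<ge> 0 \<and> \<nu> D \<ge> 0")
      case True
      have "C \<inter> D = {}" using C D \<open>A \<inter> B = {}\<close> by auto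
      then have "ennreal (\<nu> C) + ennreal (\<nu> D) = ennreal (\<nu> (C \<union> D))"
        using True C D by (subst signed_measure_Un[OF \<nu>]) (auto simp: ennreal_plus)
      also have "\<dots> \<le> s (A \<union> B)" using C D by (intro upper) auto
      finally show ?thesis .
    next
      case False
      moreover have "ennreal (\<nu> C) \<le> s (A \<union> B)" "ennreal (\<nu> D) \<le> s (A \<union> B)"
        using C D by (auto intro!: upper)
      ultimately show ?thesis by (auto simp: not_le ennreal_neg)
    qed
    have 2: "ennreal (\<nu> C) + s B \<le> s (A \<union> B)" if "C \<in> sets N" "C \<subseteq> A" for C
      unfolding s_def[of B]
      by (subst ennreal_SUP_add_right) (use that in \<open>auto intro!: SUP_least 1\<close>)
    show ?thesis
      unfolding s_def[of A]
      by (subst ennreal_SUP_add_left[symmetric]) (auto intro!: SUP_least 2)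
  qed
  have ca: "countably_additive (sets N) s"
  proof (rule countably_additiveI)
    fix A :: "nat \<Rightarrow> _" assume A: "range A \<subseteq> sets N" "disjoint_family A" "(\<Union>i. A i) \<in> sets N"
    have fin: "(\<Sum>i<n. s (A i)) \<le> s (\<Union>i<n. A i)" for n
    proof (induction n)
      case (Suc n)
      have "A i \<inter> A n = {}" if "i < n" for i
        using disjoint_family_onD[OF A(2), of i n] that by simp
      then have "(\<Union>i<n. A i) \<inter> A n = {}" by blast
      from order_trans[OF add_right_mono[OF Suc, of "s (A n)"] add[OF this]] show ?case
        by (simp add: lessThan_Suc Un_commute add.commute)
    qed simp
    have mono: "s A \<le> s B" if "A \<subseteq> B" for A B
      by (rule least) (use that in \<open>auto intro!: upper\<close>)
    show "(\<Sum>i. s (A i)) = s (\<Union>i. A i)"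
    proof (rule antisym)
      show "(\<Sum>i. s (A i)) \<le> s (\<Union>i. A i)"
        by (rule suminf_le_const) (auto intro!: order_trans[OF fin] mono)
      show "s (\<Union>i. A i) \<le> (\<Sum>i. s (A i))"
      proof (rule least)
        fix B assume B: "B \<in> sets N" "B \<subseteq> (\<Union>i. A i)"
        have "(\<lambda>i. \<nu> (B \<inter> A i)) sums \<nu> (\<Union>i. B \<inter> A i)"
          using A B by (intro signed_measure_sums[OF \<nu>]) (auto simp: disjoint_family_on_def)
        moreover have "(\<Union>i. B \<inter> A i) = B" using B by auto
        ultimately have lim: "(\<lambda>n. \<Sum>i<n. \<nu> (B \<inter> A i)) \<longlonglongrightarrow> \<nu> B"
          by (simp add: sums_def)
        have "ennreal (\<Sum>i<n. \<nu> (B \<inter> A i)) \<le> (\<Sum>i. s (A i))" for n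
        proof -
          have "ennreal (\<Sum>i<n. \<nu> (B \<inter> A i)) \<le> ennreal (\<Sum>i<n. max 0 (\<nu> (B \<inter> A i)))"
            by (intro ennreal_leI sum_mono) auto
          also have "\<dots> = (\<Sum>i<n. ennreal (max 0 (\<nu> (B \<inter> A i))))"
            by (rule sum_ennreal[symmetric]) auto
          also have "\<dots> \<le> (\<Sum>i<n. s (A i))"
            using A B by (intro sum_mono) (auto simp: max_def not_le ennreal_neg intro!: upper)
          also have "\<dots> \<le> (\<Sum>i. s (A i))" by (rule sum_le_suminf) auto
          finally show ?thesis .
        qed
        then show "ennreal (\<nu> B) \<le> (\<Sum>i. s (A i))"
          by (intro LIMSEQ_le_const2[OF tendsto_ennrealI[OF lim]]) auto
      qed
    qed
  qed
  have "pos_var N \<nu> = measure_of (space N) (sets N) s"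
    by (simp add: pos_var_def s_def[abs_def])
  then show ?thesis
    using emeasure_measure_of_sigma[OF sets.sigma_algebra_axioms pos ca A]
    by (simp add: s_def)
qed

lemma emeasure_neg_var:
  assumes "signed_measure N \<nu>" "A \<in> sets N"
  shows "emeasure (neg_var N \<nu>) A = (SUP B\<in>{B \<in> sets N. B \<subseteq> A}. ennreal (- \<nu> B))"
  unfolding neg_var_def by (rule emeasure_pos_var[OF signed_measure_minus]) fact+

lemma emeasure_measure_add:
  assumes [simp]: "sets Q = sets P" and A: "A \<in> sets P"
  shows "emeasure (measure_add P Q) A = emeasure P A + emeasure Q A"
  unfolding measure_add_def
proof (rule emeasure_measure_of_sigma[OF sets.sigma_algebra_axioms _ _ A])
  show "positive (sets P) (\<lambda>A. emeasure P A + emeasure Q A)"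
    by (simp add: positive_def)
  show "countably_additive (sets P) (\<lambda>A. emeasure P A + emeasure Q A)"
    by (rule countably_additiveI) (simp add: suminf_add[symmetric] suminf_emeasure)
qed

lemma emeasure_variation:
  "A \<in> sets N \<Longrightarrow> emeasure (variation N \<nu>) A = emeasure (pos_var N \<nu>) A + emeasure (neg_var N \<nu>) A"
  by (simp add: variation_def emeasure_measure_add)

text \<open>A known Hahn set \<open>P\<close> turns the supremum into an evaluation: cutting a
  competitor \<open>B\<close> down to \<open>P\<close> and then adding
  \<open>(A - B) \<inter> P\<close> never lowers its value.\<close>

lemma pos_var_eq:
  assumes \<nu>: "signed_measure N \<nu>" and A: "A \<in> sets N" and P: "P \<in> sets N"
    and ge: "\<And>B. B \<in> sets N \<Longrightarrow> B \<subseteq> P \<Longrightarrow> \<nu> B \<ge> 0"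
    and le: "\<And>B. B \<in> sets N \<Longrightarrow> B \<inter> P = {} \<Longrightarrow> \<nu> B \<le> 0"
  shows "emeasure (pos_var N \<nu>) A = ennreal (\<nu> (A \<inter> P))"
  unfolding emeasure_pos_var[OF \<nu> A]
proof (rule antisym)
  show "(SUP B\<in>{B \<in> sets N. B \<subseteq> A}. ennreal (\<nu> B)) \<le> ennreal (\<nu> (A \<inter> P))"
  proof (rule SUP_least, safe intro!: ennreal_leI)
    fix B assume B: "B \<in> sets N" "B \<subseteq> A"
    have "\<nu> B = \<nu> ((B \<inter> P) \<union> (B - P))" by (simp add: Int_Diff_Un)
    also have "\<dots> = \<nu> (B \<inter> P) + \<nu> (B - P)"
      using B P by (intro signed_measure_Un[OF \<nu>]) auto
    also have "\<dots> \<le> \<nu> (B \<inter> P)" using le[of "B - P"] B P by auto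
    also have "\<dots> \<le> \<nu> (B \<inter> P) + \<nu> ((A - B) \<inter> P)" using ge[of "(A - B) \<inter> P"] A B P by auto
    also have "\<dots> = \<nu> ((B \<inter> P) \<union> ((A - B) \<inter> P))"
      using A B P by (intro signed_measure_Un[OF \<nu>, symmetric]) auto
    also have "(B \<inter> P) \<union> ((A - B) \<inter> P) = A \<inter> P" using B by auto
    finally show "\<nu> B \<le> \<nu> (A \<inter> P)" .
  qed
  show "ennreal (\<nu> (A \<inter> P)) \<le> (SUP B\<in>{B \<in> sets N. B \<subseteq> A}. ennreal (\<nu> B))"
    using A P by (intro SUP_upper) auto
qed

text \<open>The number \<open>\<nu> A\<close> is itself split into positive and negative part, so
  that nothing is subtracted. A competitor \<open>B\<close> for the negative variation yields the
  competitor \<open>A - B\<close> for the positive one, which gives one inequality; replacing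
  \<open>\<nu>\<close> by its negative exchanges the two variations and gives the other.\<close>

lemma jordan:
  assumes \<nu>: "signed_measure N \<nu>" and A: "A \<in> sets N"
  shows "ennreal (\<nu> A) + emeasure (neg_var N \<nu>) A = emeasure (pos_var N \<nu>) A + ennreal (- \<nu> A)"
proof -
  have key: "ennreal (\<nu> A) + emeasure (neg_var N \<nu>) A \<le> emeasure (pos_var N \<nu>) A + ennreal (- \<nu> A)"
    if \<nu>: "signed_measure N \<nu>" for \<nu>
  proof -
    have *: "ennreal (\<nu> A) + ennreal (- \<nu> B) \<le> emeasure (pos_var N \<nu>) A + ennreal (- \<nu> A)"
      if B: "B \<in> sets N" "B \<subseteq> A" for B
    proof -
      have eq: "\<nu> A = \<nu> B + \<nu> (A - B)"
        using signed_measure_Un[OF \<nu>, of B "A - B"] A B by (simp add: Un_absorb1)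
      have "ennreal (\<nu> (A - B)) \<le> emeasure (pos_var N \<nu>) A"
        unfolding emeasure_pos_var[OF \<nu> A] using A B by (intro SUP_upper) auto
      moreover have "ennreal (\<nu> A) \<le> emeasure (pos_var N \<nu>) A"
        unfolding emeasure_pos_var[OF \<nu> A] using A B by (intro SUP_upper) auto
      moreover have "ennreal (\<nu> A) + ennreal (- \<nu> B) \<le> max (ennreal (\<nu> (A - B))) (ennreal (\<nu> A)) + ennreal (- \<nu> A)"
        unfolding eq
        by (cases "\<nu> B \<ge> 0"; cases "\<nu> (A - B) \<ge> 0"; cases "\<nu> B + \<nu> (A - B) \<ge> 0")
           (auto simp: ennreal_neg max_def ennreal_plus[symmetric] simp del: ennreal_plus intro!: ennreal_leI)
      ultimately show ?thesis
        by (meson add_right_mono max.bounded_iff order_trans)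
    qed
    show ?thesis
      unfolding emeasure_neg_var[OF \<nu> A]
      by (subst ennreal_SUP_add_right) (auto intro!: SUP_least * exI[of _ A] A)
  qed
  have "neg_var N (\<lambda>A. - \<nu> A) = pos_var N \<nu>" "pos_var N (\<lambda>A. - \<nu> A) = neg_var N \<nu>"
    by (simp_all add: neg_var_def)
  with key[OF \<nu>] key[OF signed_measure_minus[OF \<nu>]] show ?thesis
    by (simp add: add.commute antisym)
qed

lemma M_TV_D:
  assumes "\<nu> \<in> M_TV"
  shows M_TV_signed: "signed_measure borel \<nu>"
    and finite_pos_var: "finite_measure (pos_var borel \<nu>)"
    and finite_neg_var: "finite_measure (neg_var borel \<nu>)"
    and finite_variation: "finite_measure (variation borel \<nu>)"
  using assms by (auto simp: M_TV_def emeasure_variation intro!: finite_measureI)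

lemma M_TV_I:
  assumes "signed_measure borel \<nu>" "finite_measure (pos_var borel \<nu>)" "finite_measure (neg_var borel \<nu>)"
  shows "\<nu> \<in> M_TV"
  using assms finite_measure.emeasure_finite[OF assms(2), of UNIV] finite_measure.emeasure_finite[OF assms(3), of UNIV]
  by (auto simp: M_TV_def emeasure_variation less_top)

lemma tv_norm_eq:
  assumes "\<nu> \<in> M_TV"
  shows "tv_norm \<nu> = measure (pos_var borel \<nu>) UNIV + measure (neg_var borel \<nu>) UNIV"
  using finite_measure.emeasure_finite[OF M_TV_D(2)[OF assms], of UNIV]
    finite_measure.emeasure_finite[OF M_TV_D(3)[OF assms], of UNIV]
  by (simp add: tv_norm_def measure_def emeasure_variation enn2real_plus less_top)

lemma tv_norm_nonneg: "tv_norm \<nu> \<ge> 0"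
  by (simp add: tv_norm_def)

lemma measure_jordan:
  assumes "\<nu> \<in> M_TV" "A \<in> sets borel"
  shows "measure (pos_var borel \<nu>) A - measure (neg_var borel \<nu>) A = \<nu> A"
proof -
  interpret p: finite_measure "pos_var borel \<nu>" by (rule finite_pos_var) fact
  interpret n: finite_measure "neg_var borel \<nu>" by (rule finite_neg_var) fact
  have "ennreal (max 0 (\<nu> A) + measure (neg_var borel \<nu>) A) = ennreal (measure (pos_var borel \<nu>) A + max 0 (- \<nu> A))"
    using jordan[OF M_TV_signed[OF assms(1)] assms(2)]
    by (auto simp: p.emeasure_eq_measure n.emeasure_eq_measure ennreal_neg max_def)
  then have "max 0 (\<nu> A) + measure (neg_var borel \<nu>) A = measure (pos_var borel \<nu>) A + max 0 (- \<nu> A)"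
    by (subst (asm) ennreal_inj) auto
  then show ?thesis by (auto simp: max_def split: if_splits)
qed

lemma emeasure_pos_var_diff_le:
  assumes "signed_measure N \<nu>" "signed_measure N \<tau>" "A \<in> sets N"
  shows "emeasure (pos_var N (\<lambda>A. \<nu> A - \<tau> A)) A \<le> emeasure (pos_var N \<nu>) A + emeasure (neg_var N \<tau>) A"
  unfolding emeasure_pos_var[OF signed_measure_diff[OF assms(1,2)] assms(3)]
proof (rule SUP_least, safe)
  fix B assume B: "B \<in> sets N" "B \<subseteq> A"
  have "ennreal (\<nu> B - \<tau> B) \<le> ennreal (max 0 (\<nu> B) + max 0 (- \<tau> B))"
    by (intro ennreal_leI) auto
  also have "\<dots> = ennreal (\<nu> B) + ennreal (- \<tau> B)"
    by (subst ennreal_plus) (auto simp: max_def ennreal_neg)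
  also have "\<dots> \<le> emeasure (pos_var N \<nu>) A + emeasure (neg_var N \<tau>) A"
    using B by (auto simp: emeasure_pos_var emeasure_neg_var assms intro!: add_mono SUP_upper)
  finally show "ennreal (\<nu> B - \<tau> B) \<le> emeasure (pos_var N \<nu>) A + emeasure (neg_var N \<tau>) A" .
qed

lemma emeasure_neg_var_diff_le:
  assumes "signed_measure N \<nu>" "signed_measure N \<tau>" "A \<in> sets N"
  shows "emeasure (neg_var N (\<lambda>A. \<nu> A - \<tau> A)) A \<le> emeasure (neg_var N \<nu>) A + emeasure (pos_var N \<tau>) A"
  using emeasure_pos_var_diff_le[OF assms(2,1,3)] by (simp add: neg_var_def add.commute)

lemma M_TV_diff:
  assumes "\<nu> \<in> M_TV" "\<tau> \<in> M_TV"
  shows "(\<lambda>A. \<nu> A - \<tau> A) \<in> M_TV"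
proof (rule M_TV_I)
  note s = assms[THEN M_TV_signed]
  note fin = assms[THEN finite_pos_var, THEN finite_measure.emeasure_finite]
    assms[THEN finite_neg_var, THEN finite_measure.emeasure_finite]
  show "signed_measure borel (\<lambda>A. \<nu> A - \<tau> A)" by (rule signed_measure_diff[OF s])
  show "finite_measure (pos_var borel (\<lambda>A. \<nu> A - \<tau> A))"
    using emeasure_pos_var_diff_le[OF s, of UNIV] fin
    by (auto intro!: finite_measureI simp: top_unique)
  show "finite_measure (neg_var borel (\<lambda>A. \<nu> A - \<tau> A))"
    using emeasure_neg_var_diff_le[OF s, of UNIV] fin
    by (auto intro!: finite_measureI simp: top_unique)
qed

lemma tv_norm_diff_le:
  assumes "\<nu> \<in> M_TV" "\<tau> \<in> M_TV"
  shows "tv_norm (\<lambda>A. \<nu> A - \<tau> A) \<le> tv_norm \<nu> + tv_norm \<tau>"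
proof -
  let ?\<sigma> = "\<lambda>A. \<nu> A - \<tau> A"
  note em = finite_measure.emeasure_eq_measure[OF finite_pos_var] finite_measure.emeasure_eq_measure[OF finite_neg_var]
  have "measure (pos_var borel ?\<sigma>) UNIV \<le> measure (pos_var borel \<nu>) UNIV + measure (neg_var borel \<tau>) UNIV"
    using emeasure_pos_var_diff_le[OF assms[THEN M_TV_signed], of UNIV]
    by (simp add: em assms M_TV_diff ennreal_plus[symmetric] del: ennreal_plus)
  moreover have "measure (neg_var borel ?\<sigma>) UNIV \<le> measure (neg_var borel \<nu>) UNIV + measure (pos_var borel \<tau>) UNIV"
    using emeasure_neg_var_diff_le[OF assms[THEN M_TV_signed], of UNIV]
    by (simp add: em assms M_TV_diff ennreal_plus[symmetric] del: ennreal_plus)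
  ultimately show ?thesis by (simp add: tv_norm_eq assms M_TV_diff)
qed

text \<open>\<open>(\<nu> - \<tau>)\<^sup>+ - (\<nu> - \<tau>)\<^sup>- = \<nu>\<^sup>+ - \<nu>\<^sup>- - (\<tau>\<^sup>+ - \<tau>\<^sup>-)\<close>, with no subtraction, so that it survives tensoring with an infinite \<open>\<mu>\<close>.\<close>

lemma emeasure_jordan_diff:
  assumes "\<nu> \<in> M_TV" "\<tau> \<in> M_TV" "A \<in> sets borel"
  shows "emeasure (pos_var borel (\<lambda>A. \<nu> A - \<tau> A)) A + (emeasure (neg_var borel \<nu>) A + emeasure (pos_var borel \<tau>) A)
    = emeasure (neg_var borel (\<lambda>A. \<nu> A - \<tau> A)) A + (emeasure (pos_var borel \<nu>) A + emeasure (neg_var borel \<tau>) A)"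
proof -
  note em = finite_measure.emeasure_eq_measure[OF finite_pos_var] finite_measure.emeasure_eq_measure[OF finite_neg_var]
  show ?thesis
    using measure_jordan[OF assms(1,3)] measure_jordan[OF assms(2,3)] measure_jordan[OF M_TV_diff[OF assms(1,2)] assms(3)]
    by (simp add: em assms M_TV_diff ennreal_plus[symmetric] del: ennreal_plus)
qed

section \<open>Integration against sums of measures and signed measures\<close>

lemma nn_integral_measure_add:
  assumes [measurable_cong, simp]: "sets Q = sets P" and f: "f \<in> borel_measurable P"
  shows "(\<integral>\<^sup>+x. f x \<partial>measure_add P Q) = (\<integral>\<^sup>+x. f x \<partial>P) + (\<integral>\<^sup>+x. f x \<partial>Q)"
  using f
proof induction
  case (cong f g)
  have "(\<integral>\<^sup>+x. f x \<partial>Q) = (\<integral>\<^sup>+x. g x \<partial>Q)" "(\<integral>\<^sup>+x. f x \<partial>P) = (\<integral>\<^sup>+x. g x \<partial>P)"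
    "(\<integral>\<^sup>+x. f x \<partial>measure_add P Q) = (\<integral>\<^sup>+x. g x \<partial>measure_add P Q)"
    using cong(3) by (auto intro!: nn_integral_cong simp: sets_eq_imp_space_eq[OF assms(1)])
  then show ?case using cong(4) by simp
next
  case (set A)
  then show ?case by (simp add: emeasure_measure_add)
next
  case (mult u c)
  then show ?case by (simp add: nn_integral_cmult distrib_left)
next
  case (add u v)
  then show ?case by (simp add: nn_integral_add ac_simps)
next
  case (seq U)
  have [measurable]: "U i \<in> borel_measurable P" for i by (rule seq)
  have inc: "incseq (\<lambda>i. \<integral>\<^sup>+x. U i x \<partial>R)" for R
    using \<open>incseq U\<close> by (auto simp: incseq_def le_fun_def intro!: nn_integral_mono)
  show ?case
    using seq by (simp add: image_comp nn_integral_monotone_convergence_SUP ennreal_SUP_add inc)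
qed

lemma integral_measure_add:
  fixes f :: "'a \<Rightarrow> real"
  assumes sets: "sets Q = sets P" and P: "integrable P f" and Q: "integrable Q f"
  shows "integral\<^sup>L (measure_add P Q) f = integral\<^sup>L P f + integral\<^sup>L Q f"
proof -
  have [measurable]: "f \<in> borel_measurable P" using P by auto
  note add = nn_integral_measure_add[OF sets]
  have R: "integrable (measure_add P Q) f"
    using P Q by (simp add: integrable_iff_bounded add)
  show ?thesis
    using P Q R unfolding real_lebesgue_integral_def[OF P] real_lebesgue_integral_def[OF Q] real_lebesgue_integral_def[OF R]
    by (simp add: add real_integrable_def enn2real_plus less_top)
qed

lemma integrable_bounded:
  fixes f :: "'a \<Rightarrow> real"
  assumes "finite_measure P" "f \<in> borel_measurable P" "\<And>x. \<bar>f x\<bar> \<le> c"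
  shows "integrable P f"
  using assms by (intro finite_measure.integrable_const_bound[where B=c]) auto

text \<open>The three-term sums in \<open>emeasure_jordan_diff\<close> agree as measures.
  Integrating \<open>f\<close> over both leaves an identity between real numbers, which may be
  rearranged.\<close>

lemma signed_integral_diff:
  assumes \<nu>: "\<nu> \<in> M_TV" and \<tau>: "\<tau> \<in> M_TV"
    and f: "f \<in> borel_measurable borel" "\<And>x. \<bar>f x\<bar> \<le> c"
  shows "signed_integral borel (\<lambda>A. \<nu> A - \<tau> A) f = signed_integral borel \<nu> f - signed_integral borel \<tau> f"
proof -
  let ?\<sigma> = "\<lambda>A. \<nu> A - \<tau> A"
  note \<sigma> = M_TV_diff[OF \<nu> \<tau>]
  have int: "integrable (pos_var borel \<kappa>) f" "integrable (neg_var borel \<kappa>) f" if "\<kappa> \<in> M_TV" for \<kappa>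
    using f by (auto intro!: integrable_bounded finite_pos_var finite_neg_var that)
  have int_add: "integrable (measure_add P Q) f"
    if "finite_measure P" "finite_measure Q" "sets P = sets borel" "sets Q = sets borel" for P Q
  proof (rule integrable_bounded)
    show "finite_measure (measure_add P Q)"
      using that(1,2)[THEN finite_measure.emeasure_finite] that
      by (intro finite_measureI) (auto simp: emeasure_measure_add sets_eq_imp_space_eq[of P borel])
  qed (use f that in auto)
  have "measure_add (pos_var borel ?\<sigma>) (measure_add (neg_var borel \<nu>) (pos_var borel \<tau>))
      = measure_add (neg_var borel ?\<sigma>) (measure_add (pos_var borel \<nu>) (neg_var borel \<tau>))"
    by (rule measure_eqI) (auto simp: emeasure_measure_add emeasure_jordan_diff[OF \<nu> \<tau>])
  from arg_cong[OF this, of "\<lambda>M. integral\<^sup>L M f"] show ?thesis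
    by (simp add: integral_measure_add int int_add \<nu> \<tau> \<sigma> finite_pos_var finite_neg_var signed_integral_def)
qed

lemma signed_integral_bound:
  assumes \<nu>: "\<nu> \<in> M_TV" and f: "f \<in> borel_measurable borel" "\<And>x. \<bar>f x\<bar> \<le> c"
  shows "\<bar>signed_integral borel \<nu> f\<bar> \<le> c * tv_norm \<nu>"
proof -
  have *: "\<bar>integral\<^sup>L P f\<bar> \<le> c * measure P UNIV" if P: "finite_measure P" "sets P = sets borel" for P
  proof -
    interpret finite_measure P by fact
    have [simp]: "space P = UNIV" using sets_eq_imp_space_eq[OF P(2)] by simp
    have "integrable P f" using P f by (auto intro!: integrable_bounded)
    then have "\<bar>integral\<^sup>L P f\<bar> \<le> (\<integral>x. c \<partial>P)"
      using f by (intro order_trans[OF integral_abs_bound] integral_mono) auto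
    then show ?thesis by (simp add: mult.commute)
  qed
  show ?thesis
    using *[OF finite_pos_var[OF \<nu>]] *[OF finite_neg_var[OF \<nu>]]
    by (simp add: signed_integral_def tv_norm_eq[OF \<nu>] distrib_left)
qed

section \<open>Total variation by duality with C_0 functions\<close>

lemma inner_regular_measure:
  fixes P :: "'a::{second_countable_topology, complete_space} measure"
  assumes P: "finite_measure P" "sets P = sets borel" and B: "B \<in> sets borel" and e: "e > 0"
  obtains K where "compact K" "K \<subseteq> B" "measure P B - e < measure P K"
proof (rule ccontr)
  interpret finite_measure P by fact
  assume "\<not> thesis"
  with that have le: "measure P K \<le> measure P B - e" if "compact K" "K \<subseteq> B" for K
    using that by force
  have "emeasure P B = (SUP K \<in> {K. K \<subseteq> B \<and> compact K}. emeasure P K)"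
    using P B by (intro inner_regular) auto
  also have "\<dots> \<le> ennreal (measure P B - e)"
    by (rule SUP_least) (auto simp: emeasure_eq_measure intro!: ennreal_leI le)
  \<comment> \<open>The compact set \<open>{}\<close> shows that \<open>measure P B - e\<close> is
    nonnegative, so \<open>ennreal\<close> does not clip it.\<close>
  finally have "measure P B \<le> measure P B - e"
    using le[of "{}"] by (simp add: emeasure_eq_measure)
  with e show False by simp
qed

text \<open>The Urysohn function \<open>f\<close> need not decay at infinity. The cutoff
  \<open>g\<close> is 1 on \<open>K \<union> L\<close> and 0 outside a ball, so the product lies in
  \<open>C_zero\<close> and agrees with \<open>f\<close> on both sets.\<close>

lemma C_zero_separating:
  fixes K L :: "(real^'n) set"
  assumes K: "compact K" and L: "compact L" and KL: "K \<inter> L = {}"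
  obtains \<phi> where "\<phi> \<in> C_zero" "\<And>x. \<bar>\<phi> x\<bar> \<le> 1" "\<And>x. x \<in> K \<Longrightarrow> \<phi> x = 1" "\<And>x. x \<in> L \<Longrightarrow> \<phi> x = -1"
proof -
  obtain f where f: "continuous_on UNIV f" "\<And>x. f x \<in> closed_segment (1::real) (-1)"
    "\<And>x. x \<in> K \<Longrightarrow> f x = 1" "\<And>x. x \<in> L \<Longrightarrow> f x = -1"
    using Urysohn[OF compact_imp_closed[OF K] compact_imp_closed[OF L] KL] by metis
  obtain R where R: "K \<union> L \<subseteq> ball 0 R"
    using bounded_subset_ballD[OF compact_imp_bounded[OF compact_Un[OF K L]]] by blast
  have "closed (K \<union> L)" "closed (- ball (0::real^'n) R)" "(K \<union> L) \<inter> - ball 0 R = {}"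
    using K L R by (auto intro: compact_imp_closed)
  then obtain g where g: "continuous_on UNIV g" "\<And>x. g x \<in> closed_segment (1::real) 0"
    "\<And>x. x \<in> K \<union> L \<Longrightarrow> g x = 1" "\<And>x. x \<in> - ball 0 R \<Longrightarrow> g x = 0"
    using Urysohn[of "K \<union> L" "- ball (0::real^'n) R" 1 "0::real"] by metis
  have fb: "\<bar>f x\<bar> \<le> 1" for x using f(2)[of x] by (auto simp: closed_segment_eq_real_ivl)
  have gb: "\<bar>g x\<bar> \<le> 1" for x using g(2)[of x] by (auto simp: closed_segment_eq_real_ivl)
  show thesis
  proof (rule that[of "\<lambda>x. f x * g x"])
    have "eventually (\<lambda>x. f x * g x = 0) at_infinity"
      unfolding eventually_at_infinity by (rule exI[of _ R]) (auto intro!: g(4))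
    then have "((\<lambda>x. f x * g x) \<longlongrightarrow> 0) at_infinity"
      by (rule tendsto_eventually)
    then show "(\<lambda>x. f x * g x) \<in> C_zero"
      using f(1) g(1) by (auto simp: C_zero_def intro!: continuous_intros)
    show "\<bar>f x * g x\<bar> \<le> 1" for x
      using mult_mono[OF fb gb, of x x] by (simp add: abs_mult)
  qed (use f(3,4) g(3) in auto)
qed

text \<open>A set \<open>B\<close> that nearly attains the positive variation is an approximate Hahn
  set: \<open>B\<close> carries almost all positive mass and almost no negative mass. Inner
  regularity replaces \<open>B\<close> and its complement by compact sets \<open>K\<close> and
  \<open>L\<close>, and a test function equal to 1 on \<open>K\<close> and to -1 on \<open>L\<close>
  nearly attains the norm.\<close>

lemma tv_norm_le_dual:
  assumes \<nu>: "\<nu> \<in> M_TV"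
    and le: "\<And>\<phi>. \<phi> \<in> C_zero \<Longrightarrow> (\<And>x. \<bar>\<phi> x\<bar> \<le> 1) \<Longrightarrow> signed_integral borel \<nu> \<phi> \<le> c"
  shows "tv_norm \<nu> \<le> c"
proof (rule field_le_epsilon)
  fix e' :: real assume "e' > 0"
  \<comment> \<open>Each of \<open>K\<close> and \<open>L\<close> misses at most
    \<open>2 * e\<close> of the mass it should carry. Off these sets \<open>\<phi>\<close> may have
    the wrong sign, which doubles each loss: together \<open>8 * e\<close>.\<close>
  define e where "e = e' / 8"
  with \<open>e' > 0\<close> have e: "e > 0" by simp
  let ?p = "pos_var borel \<nu>" and ?n = "neg_var borel \<nu>"
  interpret p: finite_measure ?p by (rule finite_pos_var) fact
  interpret n: finite_measure ?n by (rule finite_neg_var) fact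
  have "\<exists>B\<in>sets borel. measure ?p UNIV - e < \<nu> B"
  proof (rule ccontr)
    assume "\<not> ?thesis"
    then have *: "\<nu> B \<le> measure ?p UNIV - e" if "B \<in> sets borel" for B using that by force
    have "emeasure ?p UNIV \<le> ennreal (measure ?p UNIV - e)"
      by (subst emeasure_pos_var[OF M_TV_signed[OF \<nu>]]) (auto intro!: SUP_least ennreal_leI *)
    then have "measure ?p UNIV \<le> measure ?p UNIV - e"
      using *[of "{}"] signed_measure_empty[OF M_TV_signed[OF \<nu>]] by (simp add: p.emeasure_eq_measure)
    with e show False by simp
  qed
  then obtain B where [measurable]: "B \<in> sets borel" and B: "measure ?p UNIV - e < \<nu> B" by blast
  obtain K where K: "compact K" "K \<subseteq> B" "measure ?p B - e < measure ?p K"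
    using inner_regular_measure[OF finite_pos_var[OF \<nu>], of B e] e by auto
  obtain L where L: "compact L" "L \<subseteq> - B" "measure ?n (- B) - e < measure ?n L"
    using inner_regular_measure[OF finite_neg_var[OF \<nu>], of "- B" e] e by auto
  have "K \<inter> L = {}" using K L by auto
  from C_zero_separating[OF K(1) L(1) this] obtain \<phi> where \<phi>: "\<phi> \<in> C_zero" "\<And>x. \<bar>\<phi> x\<bar> \<le> 1"
    "\<And>x. x \<in> K \<Longrightarrow> \<phi> x = 1" "\<And>x. x \<in> L \<Longrightarrow> \<phi> x = -1" by blast
  have [measurable]: "K \<in> sets borel" "L \<in> sets borel"
    using K L by (auto intro: borel_compact)
  have [measurable]: "\<phi> \<in> borel_measurable borel"
    using \<phi>(1) by (auto simp: C_zero_def intro: borel_measurable_continuous_onI)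
  have int: "integrable ?p \<phi>" "integrable ?n \<phi>"
    using \<phi>(2) by (auto intro!: integrable_bounded finite_pos_var finite_neg_var \<nu>)
  have "2 * measure ?p K - measure ?p UNIV = (\<integral>x. 2 * indicator K x - 1 \<partial>?p)"
    by (subst Bochner_Integration.integral_diff) (auto simp: p.emeasure_eq_measure)
  also have "\<dots> \<le> (\<integral>x. \<phi> x \<partial>?p)"
    using \<phi>(2,3) by (intro integral_mono int Bochner_Integration.integrable_diff integrable_mult_right integrable_real_indicator)
      (auto simp: p.emeasure_eq_measure indicator_def abs_le_iff minus_le_iff)
  finally have 1: "2 * measure ?p K - measure ?p UNIV \<le> (\<integral>x. \<phi> x \<partial>?p)" .
  have "(\<integral>x. \<phi> x \<partial>?n) \<le> (\<integral>x. 1 - 2 * indicator L x \<partial>?n)"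
    using \<phi>(2,4) by (intro integral_mono int Bochner_Integration.integrable_diff integrable_mult_right integrable_real_indicator)
      (auto simp: n.emeasure_eq_measure indicator_def abs_le_iff)
  also have "\<dots> = measure ?n UNIV - 2 * measure ?n L"
    by (subst Bochner_Integration.integral_diff) (auto simp: n.emeasure_eq_measure)
  finally have 2: "(\<integral>x. \<phi> x \<partial>?n) \<le> measure ?n UNIV - 2 * measure ?n L" .
  have "measure ?p B - measure ?n B = \<nu> B" by (rule measure_jordan[OF \<nu>]) simp
  moreover have "measure ?p B \<le> measure ?p UNIV" by (rule p.finite_measure_mono) auto
  moreover have "measure ?n (- B) = measure ?n UNIV - measure ?n B"
    using n.finite_measure_compl[of B] by (simp add: Compl_eq_Diff_UNIV)
  moreover have "measure ?n B \<ge> 0" by simp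
  moreover have "(\<integral>x. \<phi> x \<partial>?p) - (\<integral>x. \<phi> x \<partial>?n) \<le> c"
    using le[OF \<phi>(1,2)] by (simp add: signed_integral_def)
  ultimately have "measure ?p UNIV + measure ?n UNIV \<le> c + 8 * e"
    using K(3) L(3) B 1 2 by linarith
  then show "tv_norm \<nu> \<le> c + e'" by (simp add: tv_norm_eq[OF \<nu>] e_def)
qed

section \<open>Densities of differences of sigma-finite measures\<close>

lemma sigma_finite_measure_add:
  assumes P: "sigma_finite_measure P" and Q: "sigma_finite_measure Q" and sets: "sets Q = sets P"
  shows "sigma_finite_measure (measure_add P Q)"
proof -
  obtain A where A: "countable A" "A \<subseteq> sets P" "\<Union>A = space P" "\<forall>a\<in>A. emeasure P a \<noteq> \<infinity>"
    using sigma_finite_measure.sigma_finite_countable[OF P] by blast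
  obtain B where B: "countable B" "B \<subseteq> sets Q" "\<Union>B = space Q" "\<forall>b\<in>B. emeasure Q b \<noteq> \<infinity>"
    using sigma_finite_measure.sigma_finite_countable[OF Q] by blast
  have fin: "emeasure (measure_add P Q) (a \<inter> b) \<noteq> \<infinity>" if "a \<in> A" "b \<in> B" for a b
  proof -
    have ab: "a \<in> sets P" "b \<in> sets Q" using that A(2) B(2) by auto
    have "emeasure P (a \<inter> b) \<le> emeasure P a" "emeasure Q (a \<inter> b) \<le> emeasure Q b"
      using ab sets by (auto intro!: emeasure_mono)
    moreover have "emeasure P a < \<infinity>" "emeasure Q b < \<infinity>"
      using A(4) B(4) that by (auto simp: less_top)
    ultimately have "emeasure P (a \<inter> b) < \<infinity>" "emeasure Q (a \<inter> b) < \<infinity>"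
      using le_less_trans by blast+
    then show ?thesis using ab sets by (simp add: emeasure_measure_add less_top)
  qed
  show ?thesis
  proof (rule sigma_finite_measure.intro, intro exI conjI)
    let ?C = "(\<lambda>(a, b). a \<inter> b) ` (A \<times> B)"
    show "countable ?C" using A(1) B(1) by auto
    show "?C \<subseteq> sets (measure_add P Q)" using A(2) B(2) sets by auto
    have "\<Union>?C = \<Union>A \<inter> \<Union>B" by auto
    then show "\<Union>?C = space (measure_add P Q)"
      using A(3) B(3) sets_eq_imp_space_eq[OF sets] by simp
    show "\<forall>c\<in>?C. emeasure (measure_add P Q) c \<noteq> \<infinity>" using fin by auto
  qed
qed

lemma absolutely_continuous_measure_add:
  assumes "sets Q = sets P"
  shows "absolutely_continuous (measure_add P Q) P" "absolutely_continuous (measure_add P Q) Q"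
  using assms by (auto simp: absolutely_continuous_def null_sets_def emeasure_measure_add)

lemma absolutely_continuous_trans:
  "absolutely_continuous L M \<Longrightarrow> absolutely_continuous M N \<Longrightarrow> absolutely_continuous L N"
  by (auto simp: absolutely_continuous_def)

lemma radon_measure_sigma_finite:
  assumes "radon_measure \<mu>"
  shows "sigma_finite_measure \<mu>"
proof (rule sigma_finite_measure.intro, intro exI conjI)
  have sets: "sets \<mu> = sets borel" and fin: "\<And>K. compact K \<Longrightarrow> emeasure \<mu> K < \<infinity>"
    using assms by (auto simp: radon_measure_def)
  let ?C = "range (\<lambda>n::nat. cball 0 (real n))"
  show "countable ?C" by simp
  show "?C \<subseteq> sets \<mu>" by (auto simp: sets)
  show "\<Union>?C = space \<mu>"
    by (auto simp: sets_eq_imp_space_eq[OF sets] intro: real_arch_simple)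
  show "\<forall>c\<in>?C. emeasure \<mu> c \<noteq> \<infinity>" using fin by (auto simp: less_top)
qed

section \<open>Products with \<mu>\<close>

lemma sets_pair_borel:
  fixes P :: "'a::second_countable_topology measure" and Q :: "'b::second_countable_topology measure"
  shows "sets P = sets borel \<Longrightarrow> sets Q = sets borel \<Longrightarrow> sets (P \<Otimes>\<^sub>M Q) = sets borel"
  by (simp add: borel_prod[symmetric] cong: sets_pair_measure_cong)

lemma
  fixes P :: "'a::second_countable_topology measure" and Q :: "'b::second_countable_topology measure"
  assumes "sigma_finite_measure P" "sigma_finite_measure Q" "sets P = sets borel" "sets Q = sets borel"
    and A: "A \<in> sets borel"
  shows emeasure_pair_fst: "emeasure (P \<Otimes>\<^sub>M Q) A = (\<integral>\<^sup>+x. emeasure Q (Pair x -` A) \<partial>P)"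
    and emeasure_pair_snd: "emeasure (P \<Otimes>\<^sub>M Q) A = (\<integral>\<^sup>+y. emeasure P ((\<lambda>x. (x, y)) -` A) \<partial>Q)"
    and measurable_emeasure_fst: "(\<lambda>x. emeasure Q (Pair x -` A)) \<in> borel_measurable P"
    and measurable_emeasure_snd: "(\<lambda>y. emeasure P ((\<lambda>x. (x, y)) -` A)) \<in> borel_measurable Q"
    and sigma_finite_pair: "sigma_finite_measure (P \<Otimes>\<^sub>M Q)"
proof -
  interpret pair_sigma_finite P Q using assms by (auto intro: pair_sigma_finite.intro)
  have A': "A \<in> sets (P \<Otimes>\<^sub>M Q)" using A sets_pair_borel[OF assms(3,4)] by simp
  show "emeasure (P \<Otimes>\<^sub>M Q) A = (\<integral>\<^sup>+x. emeasure Q (Pair x -` A) \<partial>P)"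
    "emeasure (P \<Otimes>\<^sub>M Q) A = (\<integral>\<^sup>+y. emeasure P ((\<lambda>x. (x, y)) -` A) \<partial>Q)"
    "(\<lambda>x. emeasure Q (Pair x -` A)) \<in> borel_measurable P"
    "(\<lambda>y. emeasure P ((\<lambda>x. (x, y)) -` A)) \<in> borel_measurable Q"
    by (rule M2.emeasure_pair_measure_alt[OF A'] emeasure_pair_measure_alt2[OF A']
        measurable_emeasure_Pair1[OF A'] measurable_emeasure_Pair2[OF A'])+
  show "sigma_finite_measure (P \<Otimes>\<^sub>M Q)" ..
qed

lemma borel_section:
  fixes A :: "('a::second_countable_topology \<times> 'b::second_countable_topology) set"
  assumes "A \<in> sets borel"
  shows "Pair x -` A \<in> sets borel" "(\<lambda>x. (x, y)) -` A \<in> sets borel"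
  by (auto intro!: measurable_sets_borel[OF _ assms] borel_measurable_Pair)

text \<open>The additive identity holds on every section, so integrating over \<open>\<mu>\<close>
  carries it to the products even where the values are infinite. It is meant for
  \<open>emeasure_jordan_diff\<close>.\<close>

lemma
  fixes \<mu> :: "'b::second_countable_topology measure"
    and P1 P2 P3 Q1 Q2 Q3 :: "'a::second_countable_topology measure"
  assumes \<mu>: "sigma_finite_measure \<mu>" "sets \<mu> = sets borel"
    and fin: "\<And>P. P \<in> {P1, P2, P3, Q1, Q2, Q3} \<Longrightarrow> finite_measure P \<and> sets P = sets borel"
    and eq: "\<And>A. A \<in> sets borel \<Longrightarrow>
      emeasure P1 A + (emeasure P2 A + emeasure P3 A) = emeasure Q1 A + (emeasure Q2 A + emeasure Q3 A)"
  shows emeasure_pair_add3_fst: "A \<in> sets borel \<Longrightarrow>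
      emeasure (P1 \<Otimes>\<^sub>M \<mu>) A + (emeasure (P2 \<Otimes>\<^sub>M \<mu>) A + emeasure (P3 \<Otimes>\<^sub>M \<mu>) A)
      = emeasure (Q1 \<Otimes>\<^sub>M \<mu>) A + (emeasure (Q2 \<Otimes>\<^sub>M \<mu>) A + emeasure (Q3 \<Otimes>\<^sub>M \<mu>) A)"
    and emeasure_pair_add3_snd: "B \<in> sets borel \<Longrightarrow>
      emeasure (\<mu> \<Otimes>\<^sub>M P1) B + (emeasure (\<mu> \<Otimes>\<^sub>M P2) B + emeasure (\<mu> \<Otimes>\<^sub>M P3) B)
      = emeasure (\<mu> \<Otimes>\<^sub>M Q1) B + (emeasure (\<mu> \<Otimes>\<^sub>M Q2) B + emeasure (\<mu> \<Otimes>\<^sub>M Q3) B)"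
proof -
  have sf: "sigma_finite_measure P" "sets P = sets borel" if "P \<in> {P1, P2, P3, Q1, Q2, Q3}" for P
    using fin[OF that] by (auto simp: finite_measure_def)
  show "emeasure (P1 \<Otimes>\<^sub>M \<mu>) A + (emeasure (P2 \<Otimes>\<^sub>M \<mu>) A + emeasure (P3 \<Otimes>\<^sub>M \<mu>) A)
      = emeasure (Q1 \<Otimes>\<^sub>M \<mu>) A + (emeasure (Q2 \<Otimes>\<^sub>M \<mu>) A + emeasure (Q3 \<Otimes>\<^sub>M \<mu>) A)"
    if A: "A \<in> sets borel" for A :: "('a \<times> 'b) set"
  proof -
    have m: "(\<lambda>y. emeasure P ((\<lambda>x. (x, y)) -` A)) \<in> borel_measurable \<mu>" if "P \<in> {P1, P2, P3, Q1, Q2, Q3}" for P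
      using that A by (intro measurable_emeasure_snd \<mu> sf)
    note [measurable] = m[of P1, simplified] m[of P2, simplified] m[of P3, simplified]
      m[of Q1, simplified] m[of Q2, simplified] m[of Q3, simplified]
    show ?thesis
      using A by (simp add: emeasure_pair_snd[OF sf(1) \<mu>(1) sf(2) \<mu>(2)] eq borel_section nn_integral_add[symmetric])
  qed
  show "emeasure (\<mu> \<Otimes>\<^sub>M P1) A + (emeasure (\<mu> \<Otimes>\<^sub>M P2) A + emeasure (\<mu> \<Otimes>\<^sub>M P3) A)
      = emeasure (\<mu> \<Otimes>\<^sub>M Q1) A + (emeasure (\<mu> \<Otimes>\<^sub>M Q2) A + emeasure (\<mu> \<Otimes>\<^sub>M Q3) A)"
    if A: "A \<in> sets borel" for A :: "('b \<times> 'a) set"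
  proof -
    have m: "(\<lambda>x. emeasure P (Pair x -` A)) \<in> borel_measurable \<mu>" if "P \<in> {P1, P2, P3, Q1, Q2, Q3}" for P
      using that A by (intro measurable_emeasure_fst \<mu> sf)
    note [measurable] = m[of P1, simplified] m[of P2, simplified] m[of P3, simplified]
      m[of Q1, simplified] m[of Q2, simplified] m[of Q3, simplified]
    show ?thesis
      using A by (simp add: emeasure_pair_fst[OF \<mu>(1) sf(1) \<mu>(2) sf(2)] eq borel_section nn_integral_add[symmetric])
  qed
qed

text \<open>A bound in the style of the Schur test: Tonelli with the \<open>\<mu>\<close>-integral
  inside. That integral runs over the second variable in the first claim and over the first variable
  in the second.\<close>

lemma
  fixes g :: "'a::second_countable_topology \<times> 'a \<Rightarrow> ennreal"
  assumes \<mu>: "sigma_finite_measure \<mu>" "sets \<mu> = sets borel"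
    and P: "sigma_finite_measure P" "sets P = sets borel"
    and g: "g \<in> borel_measurable borel"
  shows nn_integral_pair_le_fst: "(\<And>x. (\<integral>\<^sup>+y. g (x, y) \<partial>\<mu>) \<le> c) \<Longrightarrow> (\<integral>\<^sup>+z. g z \<partial>(P \<Otimes>\<^sub>M \<mu>)) \<le> c * emeasure P UNIV"
    and nn_integral_pair_le_snd: "(\<And>y. (\<integral>\<^sup>+x. g (x, y) \<partial>\<mu>) \<le> c) \<Longrightarrow> (\<integral>\<^sup>+z. g z \<partial>(\<mu> \<Otimes>\<^sub>M P)) \<le> c * emeasure P UNIV"
proof -
  have [simp]: "space P = UNIV" using sets_eq_imp_space_eq[OF P(2)] by simp
  show "(\<integral>\<^sup>+z. g z \<partial>(P \<Otimes>\<^sub>M \<mu>)) \<le> c * emeasure P UNIV" if "\<And>x. (\<integral>\<^sup>+y. g (x, y) \<partial>\<mu>) \<le> c"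
  proof -
    interpret pair_sigma_finite P \<mu> using \<mu> P by (auto intro: pair_sigma_finite.intro)
    have "g \<in> borel_measurable (P \<Otimes>\<^sub>M \<mu>)"
      using g by (simp add: sets_pair_borel P \<mu> cong: measurable_cong_sets)
    from M2.nn_integral_fst[OF this, symmetric]
    have "(\<integral>\<^sup>+z. g z \<partial>(P \<Otimes>\<^sub>M \<mu>)) \<le> (\<integral>\<^sup>+x. c \<partial>P)"
      by (simp only:) (intro nn_integral_mono that)
    then show ?thesis by simp
  qed
  show "(\<integral>\<^sup>+z. g z \<partial>(\<mu> \<Otimes>\<^sub>M P)) \<le> c * emeasure P UNIV" if "\<And>y. (\<integral>\<^sup>+x. g (x, y) \<partial>\<mu>) \<le> c"
  proof -
    interpret pair_sigma_finite \<mu> P using \<mu> P by (auto intro: pair_sigma_finite.intro)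
    have "g \<in> borel_measurable (\<mu> \<Otimes>\<^sub>M P)"
      using g by (simp add: sets_pair_borel P \<mu> cong: measurable_cong_sets)
    from nn_integral_snd[OF this, symmetric]
    have "(\<integral>\<^sup>+z. g z \<partial>(\<mu> \<Otimes>\<^sub>M P)) \<le> (\<integral>\<^sup>+x. c \<partial>P)"
      by (simp only:) (intro nn_integral_mono that)
    then show ?thesis by simp
  qed
qed

section \<open>Radon-Nikodym densities of differences\<close>

lemma measurable_diff_density [measurable]: "diff_density \<Lambda> P Q \<in> borel_measurable \<Lambda>"
  unfolding diff_density_def by measurable

text \<open>The hypothesis is the additive form of \<open>P3 - Q3 = (P1 - Q1) - (P2 - Q2)\<close>, whose terms may be infinite.\<close>

lemma diff_density_diff:
  assumes \<Lambda>: "sigma_finite_measure \<Lambda>"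
    and PQ: "\<And>R. R \<in> {P1, P2, P3, Q1, Q2, Q3} \<Longrightarrow>
      sigma_finite_measure R \<and> sets R = sets \<Lambda> \<and> absolutely_continuous \<Lambda> R"
    and eq: "\<And>A. A \<in> sets \<Lambda> \<Longrightarrow>
      emeasure P3 A + (emeasure Q1 A + emeasure P2 A) = emeasure Q3 A + (emeasure P1 A + emeasure Q2 A)"
  shows "AE z in \<Lambda>. diff_density \<Lambda> P3 Q3 z = diff_density \<Lambda> P1 Q1 z - diff_density \<Lambda> P2 Q2 z"
proof -
  interpret sigma_finite_measure \<Lambda> by fact
  let ?r = "RN_deriv \<Lambda>"
  have d: "(\<integral>\<^sup>+z. ?r R z * indicator A z \<partial>\<Lambda>) = emeasure R A"
    if "R \<in> {P1, P2, P3, Q1, Q2, Q3}" "A \<in> sets \<Lambda>" for R A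
    using PQ[OF that(1)] that(2) density_RN_deriv[of R] by (simp add: emeasure_density[symmetric])
  have "density \<Lambda> (\<lambda>z. ?r P3 z + (?r Q1 z + ?r P2 z)) = density \<Lambda> (\<lambda>z. ?r Q3 z + (?r P1 z + ?r Q2 z))"
    by (rule measure_eqI) (auto simp: emeasure_density distrib_right nn_integral_add d eq)
  then have sum: "AE z in \<Lambda>. ?r P3 z + (?r Q1 z + ?r P2 z) = ?r Q3 z + (?r P1 z + ?r Q2 z)"
    by (intro density_unique) auto
  \<comment> \<open>Sigma-finiteness of each measure makes its density finite almost everywhere.
    \<open>enn2real\<close> sends \<infinity> to 0 and is additive only on finite values.\<close>
  have fin: "AE z in \<Lambda>. ?r R z \<noteq> \<infinity>" if "R \<in> {P1, P2, P3, Q1, Q2, Q3}" for R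
    using PQ[OF that] by (intro RN_deriv_finite) auto
  show ?thesis
    using sum fin[of P1, simplified] fin[of P2, simplified] fin[of P3, simplified]
      fin[of Q1, simplified] fin[of Q2, simplified] fin[of Q3, simplified]
  proof eventually_elim
    case (elim z)
    have "enn2real (?r P3 z) + (enn2real (?r Q1 z) + enn2real (?r P2 z))
        = enn2real (?r Q3 z) + (enn2real (?r P1 z) + enn2real (?r Q2 z))"
      using arg_cong[OF elim(1), of enn2real] elim(2-)
      by (simp only: enn2real_plus less_top infinity_ennreal_def ennreal_add_less_top simp_thms)
    then show ?case by (simp add: diff_density_def)
  qed
qed

text \<open>The pointwise triangle inequality survives infinite densities, because
  \<open>enn2real\<close> can only lower them; one-sided control by \<open>P\<close> and
  \<open>Q\<close> is all that the flux bounds use.\<close>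

lemma nn_integral_diff_density_le:
  assumes \<Lambda>: "sigma_finite_measure \<Lambda>"
    and PQ: "\<And>R. R \<in> {P, Q} \<Longrightarrow> sets R = sets \<Lambda> \<and> absolutely_continuous \<Lambda> R"
    and g [measurable]: "g \<in> borel_measurable \<Lambda>"
  shows "(\<integral>\<^sup>+z. ennreal \<bar>diff_density \<Lambda> P Q z\<bar> * g z \<partial>\<Lambda>) \<le> (\<integral>\<^sup>+z. g z \<partial>P) + (\<integral>\<^sup>+z. g z \<partial>Q)"
proof -
  interpret sigma_finite_measure \<Lambda> by fact
  have le: "ennreal \<bar>diff_density \<Lambda> P Q z\<bar> \<le> RN_deriv \<Lambda> P z + RN_deriv \<Lambda> Q z" for z
  proof -
    have "ennreal \<bar>diff_density \<Lambda> P Q z\<bar> \<le> ennreal (enn2real (RN_deriv \<Lambda> P z) + enn2real (RN_deriv \<Lambda> Q z))"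
      by (intro ennreal_leI) (auto simp: diff_density_def abs_le_iff)
    also have "\<dots> \<le> RN_deriv \<Lambda> P z + RN_deriv \<Lambda> Q z"
      by (subst ennreal_plus) (auto simp: ennreal_enn2real_if intro!: add_mono)
    finally show ?thesis .
  qed
  have "(\<integral>\<^sup>+z. ennreal \<bar>diff_density \<Lambda> P Q z\<bar> * g z \<partial>\<Lambda>)
      \<le> (\<integral>\<^sup>+z. RN_deriv \<Lambda> P z * g z + RN_deriv \<Lambda> Q z * g z \<partial>\<Lambda>)"
    unfolding distrib_right[symmetric] by (intro nn_integral_mono mult_right_mono le) auto
  also have "\<dots> = (\<integral>\<^sup>+z. RN_deriv \<Lambda> P z * g z \<partial>\<Lambda>) + (\<integral>\<^sup>+z. RN_deriv \<Lambda> Q z * g z \<partial>\<Lambda>)"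
    by (rule nn_integral_add) auto
  also have "\<dots> = (\<integral>\<^sup>+z. g z \<partial>P) + (\<integral>\<^sup>+z. g z \<partial>Q)"
    using PQ by (simp add: RN_deriv_nn_integral)
  finally show ?thesis .
qed

text \<open>Uniqueness of densities gives the chain rule in \<open>ennreal\<close>; it passes to the
  reals because \<open>enn2real\<close> is multiplicative even at \<infinity>.\<close>

lemma RN_deriv_chain:
  assumes L: "sigma_finite_measure L" and K: "sigma_finite_measure K"
    and LK: "absolutely_continuous L K" "sets K = sets L"
    and KP: "absolutely_continuous K P" "sets P = sets K"
  shows "AE z in L. enn2real (RN_deriv L P z) = enn2real (RN_deriv L K z) * enn2real (RN_deriv K P z)"
proof -
  interpret L: sigma_finite_measure L by fact
  interpret K: sigma_finite_measure K by fact
  have [measurable]: "RN_deriv K P \<in> borel_measurable L"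
    using borel_measurable_RN_deriv[of K P] LK(2) by (simp cong: measurable_cong_sets)
  have "density L (\<lambda>z. RN_deriv L K z * RN_deriv K P z) = density (density L (RN_deriv L K)) (RN_deriv K P)"
    by (rule density_density_eq[symmetric]) auto
  also have "\<dots> = P" using LK KP by (simp add: L.density_RN_deriv K.density_RN_deriv)
  finally have "AE z in L. RN_deriv L K z * RN_deriv K P z = RN_deriv L P z"
    by (intro L.RN_deriv_unique) auto
  then show ?thesis by eventually_elim (simp add: enn2real_mult[symmetric])
qed

lemma diff_density_chain:
  assumes "sigma_finite_measure L" "sigma_finite_measure K"
    and "absolutely_continuous L K" "sets K = sets L"
    and "absolutely_continuous K P" "sets P = sets K" "absolutely_continuous K Q" "sets Q = sets K"
  shows "AE z in L. diff_density L P Q z = enn2real (RN_deriv L K z) * diff_density K P Q z"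
  using RN_deriv_chain[OF assms(1-4) assms(5,6)] RN_deriv_chain[OF assms(1-4) assms(7,8)]
  by eventually_elim (simp add: diff_density_def right_diff_distrib)

section \<open>Lipschitz dependence of the flux\<close>

abbreviation flux_base :: "(real^'n) measure \<Rightarrow> ((real^'n) set \<Rightarrow> real) \<Rightarrow> ((real^'n) \<times> (real^'n)) measure" where
  "flux_base \<mu> \<rho> \<equiv> measure_add (variation borel \<rho> \<Otimes>\<^sub>M \<mu>) (\<mu> \<Otimes>\<^sub>M variation borel \<rho>)"

text \<open>With \<open>snd_density\<close>, these are the densities of
  \<open>\<rho> \<otimes> \<mu>\<close> and \<open>\<mu> \<otimes> \<rho>\<close> that
  \<open>\<Phi>\<close> takes as arguments. The dominating measure is left free so that two fluxes
  can be written over a common one.\<close>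

definition fst_density :: "((real^'n) \<times> (real^'n)) measure \<Rightarrow> (real^'n) measure \<Rightarrow> ((real^'n) set \<Rightarrow> real)
    \<Rightarrow> (real^'n) \<times> (real^'n) \<Rightarrow> real" where
  "fst_density \<Lambda> \<mu> \<rho> = diff_density \<Lambda> (pos_var borel \<rho> \<Otimes>\<^sub>M \<mu>) (neg_var borel \<rho> \<Otimes>\<^sub>M \<mu>)"

definition snd_density :: "((real^'n) \<times> (real^'n)) measure \<Rightarrow> (real^'n) measure \<Rightarrow> ((real^'n) set \<Rightarrow> real)
    \<Rightarrow> (real^'n) \<times> (real^'n) \<Rightarrow> real" where
  "snd_density \<Lambda> \<mu> \<rho> = diff_density \<Lambda> (\<mu> \<Otimes>\<^sub>M pos_var borel \<rho>) (\<mu> \<Otimes>\<^sub>M neg_var borel \<rho>)"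

definition flux_density :: "((real^'n) \<times> (real^'n)) measure \<Rightarrow> (real \<Rightarrow> real \<Rightarrow> real \<Rightarrow> real) \<Rightarrow> (real^'n) measure
    \<Rightarrow> ((real^'n) \<times> (real^'n) \<Rightarrow> real) \<Rightarrow> ((real^'n) set \<Rightarrow> real) \<Rightarrow> ((real^'n) \<times> (real^'n) \<Rightarrow> real)
    \<Rightarrow> (real^'n) \<times> (real^'n) \<Rightarrow> real" where
  "flux_density \<Lambda> \<Phi> \<mu> \<eta> \<rho> w z = \<Phi> (fst_density \<Lambda> \<mu> \<rho> z) (snd_density \<Lambda> \<mu> \<rho> z) (w z) * \<eta> z"

lemma offdiag_borel_set [measurable, simp]: "(offdiag :: ((real^'n) \<times> (real^'n)) set) \<in> sets borel"
proof -
  have "open (offdiag :: ((real^'n) \<times> (real^'n)) set)"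
    unfolding offdiag_def case_prod_beta by (intro open_Collect_neq continuous_intros)
  then show ?thesis by simp
qed

lemma sets_restrict_offdiag: "sets \<Lambda> = sets borel \<Longrightarrow> sets (restrict_space \<Lambda> offdiag) = sets offdiag_borel"
  by (rule sets_restrict_space_cong)

lemma sets_flux_base: "sets \<mu> = sets borel \<Longrightarrow> sets (flux_base \<mu> \<rho>) = sets borel"
  by (simp add: sets_pair_borel)

text \<open>The variation dominates both Jordan parts, and integrating over sections carries this to
  the products with \<open>\<mu>\<close>. A null set of the base is therefore null for all four
  products.\<close>

lemma
  assumes \<mu>: "radon_measure \<mu>" and \<rho>: "\<rho> \<in> M_TV"
  shows sigma_finite_flux_base: "sigma_finite_measure (flux_base \<mu> \<rho>)"
    and flux_base_dominates: "R \<in> {pos_var borel \<rho> \<Otimes>\<^sub>M \<mu>, neg_var borel \<rho> \<Otimes>\<^sub>M \<mu>, \<mu> \<Otimes>\<^sub>M pos_var borel \<rho>, \<mu> \<Otimes>\<^sub>M neg_var borel \<rho>} \<Longrightarrow>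
      sigma_finite_measure R \<and> sets R = sets borel \<and> absolutely_continuous (flux_base \<mu> \<rho>) R"
proof -
  have m: "sigma_finite_measure \<mu>" "sets \<mu> = sets borel"
    using \<mu> by (auto simp: radon_measure_def intro: radon_measure_sigma_finite)
  let ?v = "variation borel \<rho>"
  have v: "sigma_finite_measure ?v" "sets ?v = sets borel"
    using finite_variation[OF \<rho>] by (auto simp: finite_measure_def)
  have sets: "sets (?v \<Otimes>\<^sub>M \<mu>) = sets borel" "sets (\<mu> \<Otimes>\<^sub>M ?v) = sets borel"
    using m v by (auto simp: sets_pair_borel)
  show "sigma_finite_measure (flux_base \<mu> \<rho>)"
    using m v sets by (intro sigma_finite_measure_add sigma_finite_pair[where A="{}"]) auto
  note ac_base = absolutely_continuous_measure_add[of "\<mu> \<Otimes>\<^sub>M ?v" "?v \<Otimes>\<^sub>M \<mu>", unfolded sets, OF refl]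
  have ac: "sigma_finite_measure (P \<Otimes>\<^sub>M \<mu>) \<and> sets (P \<Otimes>\<^sub>M \<mu>) = sets borel \<and> absolutely_continuous (flux_base \<mu> \<rho>) (P \<Otimes>\<^sub>M \<mu>) \<and>
     sigma_finite_measure (\<mu> \<Otimes>\<^sub>M P) \<and> sets (\<mu> \<Otimes>\<^sub>M P) = sets borel \<and> absolutely_continuous (flux_base \<mu> \<rho>) (\<mu> \<Otimes>\<^sub>M P)"
    if P: "finite_measure P" "sets P = sets borel" and le: "\<And>A. A \<in> sets borel \<Longrightarrow> emeasure P A \<le> emeasure ?v A" for P
  proof (intro conjI)
    have P': "sigma_finite_measure P" using P by (simp add: finite_measure_def)
    show s1: "sets (P \<Otimes>\<^sub>M \<mu>) = sets borel" and s2: "sets (\<mu> \<Otimes>\<^sub>M P) = sets borel"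
      using m P by (auto simp: sets_pair_borel)
    show "sigma_finite_measure (P \<Otimes>\<^sub>M \<mu>)" "sigma_finite_measure (\<mu> \<Otimes>\<^sub>M P)"
      using m P P' by (auto intro!: sigma_finite_pair[where A="{}"])
    have "emeasure (P \<Otimes>\<^sub>M \<mu>) A \<le> emeasure (?v \<Otimes>\<^sub>M \<mu>) A" if "A \<in> sets borel" for A
      using that emeasure_pair_snd[OF P' m(1) P(2) m(2)] emeasure_pair_snd[OF v(1) m(1) v(2) m(2)]
      by (auto intro!: nn_integral_mono le borel_section)
    then have "absolutely_continuous (?v \<Otimes>\<^sub>M \<mu>) (P \<Otimes>\<^sub>M \<mu>)"
      unfolding absolutely_continuous_def null_sets_def sets s1 by (force simp: le_zero_eq)
    then show "absolutely_continuous (flux_base \<mu> \<rho>) (P \<Otimes>\<^sub>M \<mu>)"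
      by (rule absolutely_continuous_trans[OF ac_base(1)])
    have "emeasure (\<mu> \<Otimes>\<^sub>M P) A \<le> emeasure (\<mu> \<Otimes>\<^sub>M ?v) A" if "A \<in> sets borel" for A
      using that emeasure_pair_fst[OF m(1) P' m(2) P(2)] emeasure_pair_fst[OF m(1) v(1) m(2) v(2)]
      by (auto intro!: nn_integral_mono le borel_section)
    then have "absolutely_continuous (\<mu> \<Otimes>\<^sub>M ?v) (\<mu> \<Otimes>\<^sub>M P)"
      unfolding absolutely_continuous_def null_sets_def sets s2 by (force simp: le_zero_eq)
    then show "absolutely_continuous (flux_base \<mu> \<rho>) (\<mu> \<Otimes>\<^sub>M P)"
      by (rule absolutely_continuous_trans[OF ac_base(2)])
  qed
  have "emeasure (pos_var borel \<rho>) A \<le> emeasure ?v A" "emeasure (neg_var borel \<rho>) A \<le> emeasure ?v A"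
    if "A \<in> sets borel" for A
    using that by (auto simp: emeasure_variation)
  note dom = ac[OF finite_pos_var[OF \<rho>] sets_pos_var this(1)] ac[OF finite_neg_var[OF \<rho>] sets_neg_var this(2)]
  show "sigma_finite_measure R \<and> sets R = sets borel \<and> absolutely_continuous (flux_base \<mu> \<rho>) R"
    if "R \<in> {pos_var borel \<rho> \<Otimes>\<^sub>M \<mu>, neg_var borel \<rho> \<Otimes>\<^sub>M \<mu>, \<mu> \<Otimes>\<^sub>M pos_var borel \<rho>, \<mu> \<Otimes>\<^sub>M neg_var borel \<rho>}"
    using that dom by blast
qed

section \<open>The flux over an arbitrary dominating measure\<close>

lemma measurable_density:
  assumes "sets \<Lambda> = sets borel"
  shows "fst_density \<Lambda> \<mu> \<rho> \<in> borel_measurable borel" "snd_density \<Lambda> \<mu> \<rho> \<in> borel_measurable borel"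
  using measurable_diff_density[of \<Lambda>] assms
  by (auto simp: fst_density_def snd_density_def cong: measurable_cong_sets)

lemma measurable_flux_density:
  assumes "admissible_interp L \<Phi>" "sets \<Lambda> = sets borel"
    and [measurable]: "w \<in> borel_measurable offdiag_borel" "\<eta> \<in> borel_measurable offdiag_borel"
  shows "flux_density \<Lambda> \<Phi> \<mu> \<eta> \<rho> w \<in> borel_measurable offdiag_borel"
proof -
  note [measurable] = measurable_density[OF assms(2), of \<mu> \<rho>, THEN measurable_restrict_space1]
  have \<Phi> [measurable]: "(\<lambda>(a, b, v). \<Phi> a b v) \<in> borel_measurable borel"
    using assms(1) by (simp add: admissible_interp_def)
  have "(\<lambda>z. (fst_density \<Lambda> \<mu> \<rho> z, snd_density \<Lambda> \<mu> \<rho> z, w z)) \<in> borel_measurable offdiag_borel"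
    by measurable
  from measurable_compose[OF this \<Phi>] show ?thesis
    unfolding flux_density_def by simp
qed

text \<open>Fields are measurable off the diagonal only, whereas \<open>flux_wrt\<close> integrates
  over the whole product. The indicator of \<open>A\<close> removes the diagonal.\<close>

lemma borel_measurable_indicator_offdiag:
  fixes f :: "(real^'n) \<times> (real^'n) \<Rightarrow> real"
  assumes f: "f \<in> borel_measurable offdiag_borel" and A: "A \<in> sets offdiag_borel"
  shows "(\<lambda>z. indicator A z *\<^sub>R f z) \<in> borel_measurable borel"
proof -
  have "A \<subseteq> offdiag" "A \<in> sets borel" using A by (auto simp: sets_restrict_space)
  then have "(\<lambda>z. indicator A z *\<^sub>R f z) = (\<lambda>z. indicator A z *\<^sub>R (indicator offdiag z *\<^sub>R f z))"
    by (auto simp: fun_eq_iff indicator_def)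
  moreover have "(\<lambda>z. indicator offdiag z *\<^sub>R f z) \<in> borel_measurable borel"
    using f by (subst (asm) borel_measurable_restrict_space_iff) auto
  ultimately show ?thesis using \<open>A \<in> sets borel\<close> by simp
qed

text \<open>Homogeneity is assumed for positive factors. The factor 0, which a density may take, is
  covered by \<open>\<Phi> 0 0 w = 0\<close>.\<close>

lemma admissible_interp_homogeneous:
  assumes "admissible_interp L \<Phi>" "c \<ge> 0"
  shows "c * \<Phi> a b w = \<Phi> (c * a) (c * b) w"
  using assms by (cases "c = 0") (auto simp: admissible_interp_def)

text \<open>Let \<open>g\<close> be the density of the canonical base \<open>?K\<close> with respect
  to \<open>\<Lambda>\<close>. By the chain rule both arguments of \<open>\<Phi>\<close> over
  \<open>\<Lambda>\<close> are \<open>g\<close> times those over \<open>?K\<close>; homogeneity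
  pulls \<open>g\<close> out, and \<open>g\<close> times \<open>\<Lambda>\<close> is
  \<open>?K\<close> again. The restriction to \<open>offdiag\<close> prepares the use of
  \<open>signed_integral_density\<close>.\<close>

lemma flux_eq:
  fixes \<mu> :: "(real^'n) measure"
  assumes \<Phi>: "admissible_interp L \<Phi>" and \<mu>: "radon_measure \<mu>" and \<rho>: "\<rho> \<in> M_TV"
    and w: "w \<in> borel_measurable offdiag_borel" and \<eta>: "\<eta> \<in> borel_measurable offdiag_borel"
    and \<Lambda>: "sigma_finite_measure \<Lambda>" "sets \<Lambda> = sets borel" "absolutely_continuous \<Lambda> (flux_base \<mu> \<rho>)"
  shows "flux \<Phi> \<mu> \<eta> \<rho> w = (\<lambda>A. if A \<in> sets (restrict_space \<Lambda> offdiag)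
      then LINT z:A|restrict_space \<Lambda> offdiag. flux_density \<Lambda> \<Phi> \<mu> \<eta> \<rho> w z else 0)"
proof
  fix A
  let ?K = "flux_base \<mu> \<rho>"
  define g where "g z = enn2real (RN_deriv \<Lambda> ?K z)" for z
  have m: "sets \<mu> = sets borel" using \<mu> by (simp add: radon_measure_def)
  have K: "sigma_finite_measure ?K" "sets ?K = sets borel"
    using sigma_finite_flux_base[OF \<mu> \<rho>] sets_flux_base[OF m] by auto
  note [simp] = sets_restrict_offdiag[OF \<Lambda>(2)]
  show "flux \<Phi> \<mu> \<eta> \<rho> w A = (if A \<in> sets (restrict_space \<Lambda> offdiag)
      then LINT z:A|restrict_space \<Lambda> offdiag. flux_density \<Lambda> \<Phi> \<mu> \<eta> \<rho> w z else 0)"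
  proof (cases "A \<in> sets offdiag_borel")
    case False
    then show ?thesis by (simp add: flux_def flux_wrt_def)
  next
    case A: True
    interpret \<Lambda>: sigma_finite_measure \<Lambda> by fact
    have [measurable_cong]: "sets \<Lambda> = sets borel" by fact
    note F = borel_measurable_indicator_offdiag[OF measurable_flux_density[OF \<Phi> _ w \<eta>, of _ \<mu> \<rho>] A]
    note [measurable] = F[OF K(2)] F[OF \<Lambda>(2)]
    have [measurable]: "g \<in> borel_measurable borel"
      using borel_measurable_RN_deriv[of \<Lambda> ?K] \<Lambda>(2) unfolding g_def
      by (simp cong: measurable_cong_sets)
    \<comment> \<open>The real-valued \<open>g\<close> still reproduces \<open>?K\<close>, since the
      Radon-Nikodym derivative is finite almost everywhere.\<close>
    have "AE z in \<Lambda>. RN_deriv \<Lambda> ?K z \<noteq> \<infinity>"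
      by (rule \<Lambda>.RN_deriv_finite) (use K \<Lambda> in auto)
    then have "density \<Lambda> (\<lambda>z. ennreal (g z)) = density \<Lambda> (RN_deriv \<Lambda> ?K)"
      by (intro density_cong) (auto simp: g_def less_top)
    also have "\<dots> = ?K" by (rule \<Lambda>.density_RN_deriv) (use K \<Lambda> in auto)
    finally have K_eq: "density \<Lambda> (\<lambda>z. ennreal (g z)) = ?K" .
    have chain: "AE z in \<Lambda>. diff_density \<Lambda> P Q z = g z * diff_density ?K P Q z"
      if "P \<in> {pos_var borel \<rho> \<Otimes>\<^sub>M \<mu>, neg_var borel \<rho> \<Otimes>\<^sub>M \<mu>, \<mu> \<Otimes>\<^sub>M pos_var borel \<rho>, \<mu> \<Otimes>\<^sub>M neg_var borel \<rho>}"
        "Q \<in> {pos_var borel \<rho> \<Otimes>\<^sub>M \<mu>, neg_var borel \<rho> \<Otimes>\<^sub>M \<mu>, \<mu> \<Otimes>\<^sub>M pos_var borel \<rho>, \<mu> \<Otimes>\<^sub>M neg_var borel \<rho>}" for P Q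
      unfolding g_def using flux_base_dominates[OF \<mu> \<rho> that(1)] flux_base_dominates[OF \<mu> \<rho> that(2)] K \<Lambda>
      by (intro diff_density_chain) auto
    have "AE z in \<Lambda>. fst_density \<Lambda> \<mu> \<rho> z = g z * fst_density ?K \<mu> \<rho> z"
      "AE z in \<Lambda>. snd_density \<Lambda> \<mu> \<rho> z = g z * snd_density ?K \<mu> \<rho> z"
      unfolding fst_density_def snd_density_def by (auto intro!: chain)
    then have ae: "AE z in \<Lambda>. g z *\<^sub>R (indicator A z *\<^sub>R flux_density ?K \<Phi> \<mu> \<eta> \<rho> w z)
        = indicator A z *\<^sub>R flux_density \<Lambda> \<Phi> \<mu> \<eta> \<rho> w z"
    proof eventually_elim
      case (elim z)
      have "g z \<ge> 0" by (simp add: g_def)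
      from admissible_interp_homogeneous[OF \<Phi> this] elim show ?case
        by (simp add: flux_density_def)
    qed
    have "flux \<Phi> \<mu> \<eta> \<rho> w A = (LINT z:A|?K. flux_density ?K \<Phi> \<mu> \<eta> \<rho> w z)"
      using A by (simp add: flux_def flux_wrt_def flux_density_def fst_density_def snd_density_def)
    also have "\<dots> = (\<integral>z. g z *\<^sub>R (indicator A z *\<^sub>R flux_density ?K \<Phi> \<mu> \<eta> \<rho> w z) \<partial>\<Lambda>)"
      unfolding set_lebesgue_integral_def
    proof (subst (1) K_eq[symmetric], rule integral_density)
      show "(\<lambda>z. indicator A z *\<^sub>R flux_density ?K \<Phi> \<mu> \<eta> \<rho> w z) \<in> borel_measurable \<Lambda>" by measurable
      show "g \<in> borel_measurable \<Lambda>" by measurable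
    qed (simp add: g_def)
    also have "\<dots> = (\<integral>z. indicator A z *\<^sub>R flux_density \<Lambda> \<Phi> \<mu> \<eta> \<rho> w z \<partial>\<Lambda>)"
      by (rule integral_cong_AE[OF _ _ ae]; measurable)
    also have "\<dots> = (\<integral>z. indicator offdiag z *\<^sub>R (indicator A z *\<^sub>R flux_density \<Lambda> \<Phi> \<mu> \<eta> \<rho> w z) \<partial>\<Lambda>)"
      using A by (intro Bochner_Integration.integral_cong) (auto simp: indicator_def sets_restrict_space)
    also have "\<dots> = (LINT z:A|restrict_space \<Lambda> offdiag. flux_density \<Lambda> \<Phi> \<mu> \<eta> \<rho> w z)"
      unfolding set_lebesgue_integral_def using \<Lambda>(2)
      by (intro integral_restrict_space[symmetric]) (auto simp: sets_eq_imp_space_eq[OF \<Lambda>(2)])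
    finally show ?thesis using A by simp
  qed
qed

section \<open>Signed measures given by an integrable density\<close>

lemma signed_measure_density:
  fixes f :: "'a \<Rightarrow> real"
  assumes f: "integrable N f"
  shows "signed_measure N (\<lambda>A. if A \<in> sets N then LINT x:A|N. f x else 0)"
  unfolding signed_measure_def
proof (intro conjI allI impI)
  fix A :: "nat \<Rightarrow> 'a set" assume A: "range A \<subseteq> sets N" "disjoint_family A"
  have [measurable]: "A i \<in> sets N" for i using A(1) by auto
  have int: "set_integrable N B f" if "B \<in> sets N" for B
    unfolding set_integrable_def using that f by (rule integrable_mult_indicator)
  have "(\<lambda>n. LINT x:(\<Union>i<n. A i)|N. f x) \<longlonglongrightarrow> (LINT x:(\<Union>n. \<Union>i<n. A i)|N. f x)"
    by (rule set_integral_cont_up) (auto intro!: int incseq_SucI simp: lessThan_Suc)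
  moreover have "(LINT x:(\<Union>i<n. A i)|N. f x) = (\<Sum>i<n. LINT x:A i|N. f x)" for n
    using A(2) by (intro set_integral_finite_Union) (auto simp: disjoint_family_on_def intro!: int)
  moreover have "(\<Union>n. \<Union>i<n. A i) = (\<Union>i. A i)" by auto
  ultimately show "(\<lambda>i. if A i \<in> sets N then LINT x:A i|N. f x else 0) sums
      (if (\<Union>i. A i) \<in> sets N then LINT x:(\<Union>i. A i)|N. f x else 0)"
    by (simp add: sums_def)
qed (auto simp: set_lebesgue_integral_def)

text \<open>The set where \<open>f\<close> is positive is a Hahn set, so \<open>pos_var_eq\<close>
  applies.\<close>

lemma pos_var_density:
  fixes f :: "'a \<Rightarrow> real"
  assumes f: "integrable N f"
  shows "pos_var N (\<lambda>A. if A \<in> sets N then LINT x:A|N. f x else 0) = density N (\<lambda>x. ennreal (max 0 (f x)))"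
proof (rule measure_eqI)
  let ?\<nu> = "\<lambda>A. if A \<in> sets N then LINT x:A|N. f x else 0"
  have [measurable]: "f \<in> borel_measurable N" using f by auto
  fix A assume "A \<in> sets (pos_var N ?\<nu>)"
  then have [measurable]: "A \<in> sets N" by simp
  define P where "P = {x \<in> space N. f x > 0}"
  have [measurable]: "P \<in> sets N" by (simp add: P_def)
  have int: "set_integrable N B f" if "B \<in> sets N" for B
    unfolding set_integrable_def using that f by (rule integrable_mult_indicator)
  have "emeasure (pos_var N ?\<nu>) A = ennreal (?\<nu> (A \<inter> P))"
  proof (rule pos_var_eq[OF signed_measure_density[OF f]])
    show "?\<nu> B \<ge> 0" if "B \<in> sets N" "B \<subseteq> P" for B
      using that by (auto simp: set_lebesgue_integral_def P_def indicator_def intro!: Bochner_Integration.integral_nonneg)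
    show "?\<nu> B \<le> 0" if B: "B \<in> sets N" "B \<inter> P = {}" for B
    proof -
      have "(LINT x:B|N. f x) \<le> (\<integral>x. 0 \<partial>N)"
        unfolding set_lebesgue_integral_def
        using int[OF B(1)] B sets.sets_into_space[OF B(1)] unfolding set_integrable_def
        by (intro integral_mono) (auto simp: P_def indicator_def)
      then show ?thesis using B by simp
    qed
  qed auto
  also have "?\<nu> (A \<inter> P) = (\<integral>x. max 0 (f x) * indicator A x \<partial>N)"
    by (auto simp: set_lebesgue_integral_def P_def indicator_def intro!: Bochner_Integration.integral_cong)
  also have "ennreal \<dots> = (\<integral>\<^sup>+x. ennreal (max 0 (f x) * indicator A x) \<partial>N)"
    using f by (intro nn_integral_eq_integral[symmetric] integrable_real_mult_indicator) auto
  also have "\<dots> = emeasure (density N (\<lambda>x. ennreal (max 0 (f x)))) A"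
    by (auto simp: emeasure_density indicator_def intro!: nn_integral_cong)
  finally show "emeasure (pos_var N ?\<nu>) A = emeasure (density N (\<lambda>x. ennreal (max 0 (f x)))) A" .
qed simp

text \<open>Two spaces \<open>N\<close> and \<open>N'\<close> occur because the pairing is formed
  over \<open>offdiag_borel\<close> while the density lives on the restriction of a dominating
  measure. The variations depend only on the space and its measurable sets.\<close>

lemma signed_integral_density:
  fixes f \<phi> :: "'a \<Rightarrow> real"
  assumes f: "integrable N f" and \<phi> [measurable]: "\<phi> \<in> borel_measurable N" and bound: "\<And>x. \<bar>\<phi> x\<bar> \<le> c"
    and sets: "sets N' = sets N"
  shows "signed_integral N' (\<lambda>A. if A \<in> sets N then LINT x:A|N. f x else 0) \<phi> = (\<integral>x. f x * \<phi> x \<partial>N)"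
    and "integrable N (\<lambda>x. f x * \<phi> x)"
proof -
  have [measurable]: "f \<in> borel_measurable N" using f by auto
  have int: "integrable N (\<lambda>x. h x * \<phi> x)" if h: "integrable N h" for h :: "'a \<Rightarrow> real"
  proof (rule Bochner_Integration.integrable_bound)
    show "integrable N (\<lambda>x. c * h x)" using h by simp
    show "AE x in N. norm (h x * \<phi> x) \<le> norm (c * h x)"
    proof (rule AE_I2)
      fix x
      have "\<bar>h x\<bar> * \<bar>\<phi> x\<bar> \<le> \<bar>h x\<bar> * \<bar>c\<bar>"
        using bound[of x] by (intro mult_left_mono) auto
      then show "norm (h x * \<phi> x) \<le> norm (c * h x)" by (simp add: abs_mult mult.commute)
    qed
  qed (use h in auto)
  show "integrable N (\<lambda>x. f x * \<phi> x)" by (rule int[OF f])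
  let ?\<nu> = "\<lambda>A. if A \<in> sets N then LINT x:A|N. f x else 0"
  have eq: "pos_var N' \<tau> = pos_var N \<tau>" for \<tau>
    by (simp add: pos_var_def sets sets_eq_imp_space_eq[OF sets])
  have "(\<lambda>A. - ?\<nu> A) = (\<lambda>A. if A \<in> sets N then LINT x:A|N. - f x else 0)"
    by (auto simp: set_lebesgue_integral_def)
  then have "signed_integral N' ?\<nu> \<phi> = (\<integral>x. max 0 (f x) * \<phi> x \<partial>N) - (\<integral>x. max 0 (- f x) * \<phi> x \<partial>N)"
    using f by (simp add: signed_integral_def neg_var_def eq pos_var_density integral_density)
  also have "\<dots> = (\<integral>x. max 0 (f x) * \<phi> x - max 0 (- f x) * \<phi> x \<partial>N)"
    using f by (intro Bochner_Integration.integral_diff[symmetric] int) auto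
  also have "\<dots> = (\<integral>x. f x * \<phi> x \<partial>N)"
    by (intro Bochner_Integration.integral_cong) (auto simp: max_def)
  finally show "signed_integral N' ?\<nu> \<phi> = (\<integral>x. f x * \<phi> x \<partial>N)" .
qed

section \<open>Bounds on the flux\<close>

lemma set_nn_integral_Compl_singleton_offdiag:
  "(\<integral>\<^sup>+y\<in>UNIV - {x}. ennreal \<bar>v (x, y)\<bar> \<partial>\<mu>) = (\<integral>\<^sup>+y. ennreal \<bar>v (x, y)\<bar> * indicator offdiag (x, y) \<partial>\<mu>)"
  by (auto intro!: nn_integral_cong simp: offdiag_def indicator_def)

text \<open>The density is bounded by those of the two Jordan products, and the
  \<open>\<mu>\<close>-integral of the weight is carried out first. For \<open>snd_density\<close>
  it runs over the first variable; there \<open>bound\<close> applies because antisymmetry makes the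
  absolute value of \<open>v\<close> symmetric.\<close>

lemma weighted_density_bound:
  fixes \<mu> :: "(real^'n) measure" and v :: "(real^'n) \<times> (real^'n) \<Rightarrow> real"
  assumes \<mu>: "radon_measure \<mu>" and \<rho>: "\<rho> \<in> M_TV"
    and \<Lambda>: "sigma_finite_measure \<Lambda>" "sets \<Lambda> = sets borel" "absolutely_continuous \<Lambda> (flux_base \<mu> \<rho>)"
    and v: "v \<in> borel_measurable offdiag_borel" "v \<in> antisym_fields"
    and bound: "\<And>x. (\<integral>\<^sup>+y\<in>UNIV - {x}. ennreal \<bar>v (x, y)\<bar> \<partial>\<mu>) \<le> ennreal C" and C: "C \<ge> 0"
    and D: "D \<in> {fst_density \<Lambda> \<mu> \<rho>, snd_density \<Lambda> \<mu> \<rho>}"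
  shows "integrable (restrict_space \<Lambda> offdiag) (\<lambda>z. \<bar>D z\<bar> * \<bar>v z\<bar>)"
    and "(\<integral>z. \<bar>D z\<bar> * \<bar>v z\<bar> \<partial>restrict_space \<Lambda> offdiag) \<le> C * tv_norm \<rho>"
proof -
  let ?N = "restrict_space \<Lambda> offdiag"
  have m: "sigma_finite_measure \<mu>" "sets \<mu> = sets borel"
    using \<mu> by (auto simp: radon_measure_def intro: radon_measure_sigma_finite)
  \<comment> \<open>Values of \<open>v\<close> on the diagonal are arbitrary. Cutting them off makes
    \<open>g\<close> Borel on the whole product, so Tonelli can be applied there.\<close>
  define g where "g z = ennreal \<bar>v z\<bar> * indicator offdiag z" for z
  have g: "g \<in> borel_measurable borel"
    using v(1) unfolding g_def by (subst borel_measurable_restrict_space_iff_ennreal[symmetric]) auto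
  have g1: "(\<integral>\<^sup>+y. g (x, y) \<partial>\<mu>) \<le> ennreal C" for x
    using bound[of x] by (simp add: set_nn_integral_Compl_singleton_offdiag g_def)
  have "g (x, y) = g (y, x)" for x y
  proof (cases "x = y")
    case False
    then have "v (x, y) = - v (y, x)" using v(2) unfolding antisym_fields_def by blast
    then show ?thesis by (auto simp: g_def offdiag_def indicator_def)
  qed simp
  then have g2: "(\<integral>\<^sup>+x. g (x, y) \<partial>\<mu>) \<le> ennreal C" for y
    using g1[of y] by simp
  have gL: "g \<in> borel_measurable \<Lambda>" using g \<Lambda>(2) by (simp cong: measurable_cong_sets)
  have sf: "sigma_finite_measure (pos_var borel \<rho>)" "sigma_finite_measure (neg_var borel \<rho>)"
    using finite_pos_var[OF \<rho>] finite_neg_var[OF \<rho>] by (auto simp: finite_measure_def)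
  have tv: "ennreal C * emeasure (pos_var borel \<rho>) UNIV + ennreal C * emeasure (neg_var borel \<rho>) UNIV
      = ennreal (C * tv_norm \<rho>)"
    using C by (simp add: tv_norm_eq[OF \<rho>] finite_measure.emeasure_eq_measure[OF finite_pos_var[OF \<rho>]]
        finite_measure.emeasure_eq_measure[OF finite_neg_var[OF \<rho>]] ennreal_mult'[symmetric]
        ennreal_plus[symmetric] distrib_left del: ennreal_plus)
  have R: "sets R = sets \<Lambda> \<and> absolutely_continuous \<Lambda> R"
    if "R \<in> {pos_var borel \<rho> \<Otimes>\<^sub>M \<mu>, neg_var borel \<rho> \<Otimes>\<^sub>M \<mu>, \<mu> \<Otimes>\<^sub>M pos_var borel \<rho>, \<mu> \<Otimes>\<^sub>M neg_var borel \<rho>}" for R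
    using flux_base_dominates[OF \<mu> \<rho> that] \<Lambda>(2,3) absolutely_continuous_trans by blast
  have 1: "(\<integral>\<^sup>+z. ennreal \<bar>fst_density \<Lambda> \<mu> \<rho> z\<bar> * g z \<partial>\<Lambda>) \<le> ennreal (C * tv_norm \<rho>)"
    unfolding fst_density_def tv[symmetric]
    by (rule order_trans[OF nn_integral_diff_density_le[OF \<Lambda>(1) _ gL]])
      (auto intro!: R add_mono nn_integral_pair_le_fst m sf g g1)
  have 2: "(\<integral>\<^sup>+z. ennreal \<bar>snd_density \<Lambda> \<mu> \<rho> z\<bar> * g z \<partial>\<Lambda>) \<le> ennreal (C * tv_norm \<rho>)"
    unfolding snd_density_def tv[symmetric]
    by (rule order_trans[OF nn_integral_diff_density_le[OF \<Lambda>(1) _ gL]])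
      (auto intro!: R add_mono nn_integral_pair_le_snd m sf g g2)
  have "(\<integral>\<^sup>+z. ennreal (\<bar>D z\<bar> * \<bar>v z\<bar>) \<partial>?N) = (\<integral>\<^sup>+z. ennreal \<bar>D z\<bar> * g z \<partial>\<Lambda>)"
    using \<Lambda>(2) by (subst nn_integral_restrict_space)
      (auto simp: g_def ennreal_mult' mult.assoc sets_eq_imp_space_eq[OF \<Lambda>(2)])
  also have "\<dots> \<le> ennreal (C * tv_norm \<rho>)" using D 1 2 by auto
  finally have nn: "(\<integral>\<^sup>+z. ennreal (\<bar>D z\<bar> * \<bar>v z\<bar>) \<partial>?N) \<le> ennreal (C * tv_norm \<rho>)" .
  have [measurable]: "D \<in> borel_measurable offdiag_borel"
    using D measurable_density[OF \<Lambda>(2), of \<mu> \<rho>] by (auto intro: measurable_restrict_space1)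
  note [measurable] = v(1)
  have "(\<lambda>z. \<bar>D z\<bar> * \<bar>v z\<bar>) \<in> borel_measurable offdiag_borel" by measurable
  then have meas: "(\<lambda>z. \<bar>D z\<bar> * \<bar>v z\<bar>) \<in> borel_measurable ?N"
    using sets_restrict_offdiag[OF \<Lambda>(2)] by (simp cong: measurable_cong_sets)
  show "integrable ?N (\<lambda>z. \<bar>D z\<bar> * \<bar>v z\<bar>)"
    using nn by (intro integrableI_nonneg meas) (auto intro: le_less_trans)
  show "(\<integral>z. \<bar>D z\<bar> * \<bar>v z\<bar> \<partial>?N) \<le> C * tv_norm \<rho>"
    using C by (intro integral_real_bounded nn) (auto simp: tv_norm_nonneg)
qed

lemma
  assumes "admissible_interp L \<Phi>"
  shows admissible_interp_pos: "L > 0"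
    and admissible_interp_bound: "\<bar>\<Phi> a b v\<bar> \<le> L * (\<bar>a\<bar> + \<bar>b\<bar>) * \<bar>v\<bar>"
    and admissible_interp_diff: "\<bar>\<Phi> a b v - \<Phi> c d w\<bar>
      \<le> L * ((\<bar>a - c\<bar> + \<bar>b - d\<bar>) * \<bar>v\<bar> + (\<bar>c\<bar> + \<bar>d\<bar>) * \<bar>v - w\<bar>)"
proof -
  note A = assms[unfolded admissible_interp_def]
  show "L > 0" using A by simp
  have "\<bar>\<Phi> a b v - \<Phi> a b 0\<bar> \<le> L * (\<bar>a\<bar> + \<bar>b\<bar>) * \<bar>v - 0\<bar>" using A by blast
  then show "\<bar>\<Phi> a b v\<bar> \<le> L * (\<bar>a\<bar> + \<bar>b\<bar>) * \<bar>v\<bar>" using A by simp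
  \<comment> \<open>Passing through \<open>\<Phi> c d v\<close> pairs the change of densities with
    \<open>v\<close> and the change of velocity with the densities \<open>c\<close>,
    \<open>d\<close>. These are products that \<open>weighted_density_bound\<close> can
    integrate.\<close>
  have "\<bar>\<Phi> a b v - \<Phi> c d v\<bar> \<le> L * (\<bar>a - c\<bar> + \<bar>b - d\<bar>) * \<bar>v\<bar>"
    "\<bar>\<Phi> c d v - \<Phi> c d w\<bar> \<le> L * (\<bar>c\<bar> + \<bar>d\<bar>) * \<bar>v - w\<bar>"
    using A by blast+
  moreover have "L * p * x + L * q * y = L * (p * x + q * y)" for p q x y :: real
    by (simp add: algebra_simps)
  ultimately show "\<bar>\<Phi> a b v - \<Phi> c d w\<bar>
      \<le> L * ((\<bar>a - c\<bar> + \<bar>b - d\<bar>) * \<bar>v\<bar> + (\<bar>c\<bar> + \<bar>d\<bar>) * \<bar>v - w\<bar>)"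
    by (smt (verit))
qed

text \<open>The growth bound on \<open>\<Phi>\<close> and the boundedness of \<open>\<eta>\<close>
  make the flux density integrable off the diagonal, so the pairing is a single Lebesgue integral.
  The freedom in \<open>\<Lambda>\<close> allows two such pairings to be subtracted under one
  integral sign.\<close>

lemma signed_integral_flux:
  fixes \<mu> :: "(real^'n) measure"
  assumes \<Phi>: "admissible_interp L \<Phi>" and \<mu>: "radon_measure \<mu>" and \<rho>: "\<rho> \<in> M_TV"
    and w: "w \<in> borel_measurable offdiag_borel" "w \<in> antisym_fields"
    and bound: "\<And>x. (\<integral>\<^sup>+y\<in>UNIV - {x}. ennreal \<bar>w (x, y)\<bar> \<partial>\<mu>) \<le> ennreal C" and C: "C \<ge> 0"
    and \<eta>: "\<eta> \<in> C_b_offdiag"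
    and \<Lambda>: "sigma_finite_measure \<Lambda>" "sets \<Lambda> = sets borel" "absolutely_continuous \<Lambda> (flux_base \<mu> \<rho>)"
    and \<psi>: "\<psi> \<in> borel_measurable borel" "\<And>z. \<bar>\<psi> z\<bar> \<le> c"
  shows "signed_integral offdiag_borel (flux \<Phi> \<mu> \<eta> \<rho> w) \<psi>
      = (\<integral>z. flux_density \<Lambda> \<Phi> \<mu> \<eta> \<rho> w z * \<psi> z \<partial>restrict_space \<Lambda> offdiag)"
    and "integrable (restrict_space \<Lambda> offdiag) (\<lambda>z. flux_density \<Lambda> \<Phi> \<mu> \<eta> \<rho> w z * \<psi> z)"
proof -
  let ?N = "restrict_space \<Lambda> offdiag"
  note sN = sets_restrict_offdiag[OF \<Lambda>(2)]
  have \<eta>m: "\<eta> \<in> borel_measurable offdiag_borel"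
    using \<eta> by (auto simp: C_b_offdiag_def intro: borel_measurable_continuous_on_restrict)
  obtain E where E: "\<And>z. z \<in> offdiag \<Longrightarrow> \<bar>\<eta> z\<bar> \<le> E"
    using \<eta> by (force simp: C_b_offdiag_def bounded_iff)
  note W = weighted_density_bound(1)[OF \<mu> \<rho> \<Lambda> w bound C]
  let ?a = "fst_density \<Lambda> \<mu> \<rho>" and ?b = "snd_density \<Lambda> \<mu> \<rho>"
  have int: "integrable ?N (flux_density \<Lambda> \<Phi> \<mu> \<eta> \<rho> w)"
  proof (rule Bochner_Integration.integrable_bound)
    show "integrable ?N (\<lambda>z. E * L * (\<bar>?a z\<bar> * \<bar>w z\<bar> + \<bar>?b z\<bar> * \<bar>w z\<bar>))"
      by (intro integrable_mult_right Bochner_Integration.integrable_add W) auto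
    show "flux_density \<Lambda> \<Phi> \<mu> \<eta> \<rho> w \<in> borel_measurable ?N"
      using measurable_flux_density[OF \<Phi> \<Lambda>(2) w(1) \<eta>m] sN by (simp cong: measurable_cong_sets)
    show "AE z in ?N. norm (flux_density \<Lambda> \<Phi> \<mu> \<eta> \<rho> w z) \<le> norm (E * L * (\<bar>?a z\<bar> * \<bar>w z\<bar> + \<bar>?b z\<bar> * \<bar>w z\<bar>))"
    proof (rule AE_I2)
      fix z assume "z \<in> space ?N"
      then have "\<bar>\<eta> z\<bar> \<le> E" by (auto simp: space_restrict_space intro: E)
      then have "\<bar>\<Phi> (?a z) (?b z) (w z)\<bar> * \<bar>\<eta> z\<bar> \<le> (L * (\<bar>?a z\<bar> + \<bar>?b z\<bar>) * \<bar>w z\<bar>) * E"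
        using admissible_interp_pos[OF \<Phi>]
        by (intro mult_mono admissible_interp_bound[OF \<Phi>]) auto
      also have "\<dots> = E * L * (\<bar>?a z\<bar> * \<bar>w z\<bar> + \<bar>?b z\<bar> * \<bar>w z\<bar>)" by (simp add: algebra_simps)
      also have "\<dots> \<le> norm \<dots>" by (simp only: real_norm_def abs_ge_self)
      finally show "norm (flux_density \<Lambda> \<Phi> \<mu> \<eta> \<rho> w z) \<le> norm (E * L * (\<bar>?a z\<bar> * \<bar>w z\<bar> + \<bar>?b z\<bar> * \<bar>w z\<bar>))"
        by (simp only: flux_density_def real_norm_def abs_mult[of "\<Phi> _ _ _"])
    qed
  qed
  have "\<psi> \<in> borel_measurable ?N"
    using measurable_restrict_space1[OF \<psi>(1), of offdiag] sN by (simp cong: measurable_cong_sets)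
  note S = signed_integral_density[OF int this \<psi>(2) sN[symmetric]]
  show "signed_integral offdiag_borel (flux \<Phi> \<mu> \<eta> \<rho> w) \<psi>
      = (\<integral>z. flux_density \<Lambda> \<Phi> \<mu> \<eta> \<rho> w z * \<psi> z \<partial>?N)"
    unfolding flux_eq[OF \<Phi> \<mu> \<rho> w(1) \<eta>m \<Lambda>] by (rule S(1))
  show "integrable ?N (\<lambda>z. flux_density \<Lambda> \<Phi> \<mu> \<eta> \<rho> w z * \<psi> z)" by (rule S(2))
qed

text \<open>Linearity of the densities in the signed measure, which is not evident from the
  definition because Jordan parts do not subtract. It rests on the additive Jordan identity tensored
  with \<open>\<mu>\<close>.\<close>

lemma density_diff:
  fixes \<mu> :: "(real^'n) measure"
  assumes \<mu>: "radon_measure \<mu>" and \<nu>: "\<nu> \<in> M_TV" and \<tau>: "\<tau> \<in> M_TV"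
    and \<Lambda>: "sigma_finite_measure \<Lambda>" "sets \<Lambda> = sets borel" "absolutely_continuous \<Lambda> (flux_base \<mu> \<nu>)"
      "absolutely_continuous \<Lambda> (flux_base \<mu> \<tau>)" "absolutely_continuous \<Lambda> (flux_base \<mu> (\<lambda>A. \<nu> A - \<tau> A))"
  shows "AE z in \<Lambda>. fst_density \<Lambda> \<mu> (\<lambda>A. \<nu> A - \<tau> A) z = fst_density \<Lambda> \<mu> \<nu> z - fst_density \<Lambda> \<mu> \<tau> z"
    and "AE z in \<Lambda>. snd_density \<Lambda> \<mu> (\<lambda>A. \<nu> A - \<tau> A) z = snd_density \<Lambda> \<mu> \<nu> z - snd_density \<Lambda> \<mu> \<tau> z"
proof -
  have m: "sigma_finite_measure \<mu>" "sets \<mu> = sets borel"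
    using \<mu> by (auto simp: radon_measure_def intro: radon_measure_sigma_finite)
  have dom: "sigma_finite_measure R \<and> sets R = sets \<Lambda> \<and> absolutely_continuous \<Lambda> R"
    if "\<kappa> \<in> M_TV" "absolutely_continuous \<Lambda> (flux_base \<mu> \<kappa>)"
      "R \<in> {pos_var borel \<kappa> \<Otimes>\<^sub>M \<mu>, neg_var borel \<kappa> \<Otimes>\<^sub>M \<mu>, \<mu> \<Otimes>\<^sub>M pos_var borel \<kappa>, \<mu> \<Otimes>\<^sub>M neg_var borel \<kappa>}" for R \<kappa>
    using flux_base_dominates[OF \<mu> that(1,3)] \<Lambda>(2) that(2) absolutely_continuous_trans by blast
  note \<sigma> = M_TV_diff[OF \<nu> \<tau>]
  note dom\<nu> = dom[OF \<nu> \<Lambda>(3)] and dom\<tau> = dom[OF \<tau> \<Lambda>(4)] and dom\<sigma> = dom[OF \<sigma> \<Lambda>(5)]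
  have fin: "finite_measure P \<and> sets P = sets borel"
    if "P \<in> {pos_var borel (\<lambda>A. \<nu> A - \<tau> A), neg_var borel \<nu>, pos_var borel \<tau>,
      neg_var borel (\<lambda>A. \<nu> A - \<tau> A), pos_var borel \<nu>, neg_var borel \<tau>}" for P
    using that \<nu> \<tau> \<sigma> by (auto intro: finite_pos_var finite_neg_var)
  note add3 = emeasure_pair_add3_fst[OF m fin emeasure_jordan_diff[OF \<nu> \<tau>]]
    emeasure_pair_add3_snd[OF m fin emeasure_jordan_diff[OF \<nu> \<tau>]]
  show "AE z in \<Lambda>. fst_density \<Lambda> \<mu> (\<lambda>A. \<nu> A - \<tau> A) z = fst_density \<Lambda> \<mu> \<nu> z - fst_density \<Lambda> \<mu> \<tau> z"
    unfolding fst_density_def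
    by (rule diff_density_diff[OF \<Lambda>(1)])
      (use dom\<nu> dom\<tau> dom\<sigma> in blast, rule add3(1), simp_all add: \<Lambda>(2))
  show "AE z in \<Lambda>. snd_density \<Lambda> \<mu> (\<lambda>A. \<nu> A - \<tau> A) z = snd_density \<Lambda> \<mu> \<nu> z - snd_density \<Lambda> \<mu> \<tau> z"
    unfolding snd_density_def
    by (rule diff_density_diff[OF \<Lambda>(1)])
      (use dom\<nu> dom\<tau> dom\<sigma> in blast, rule add3(2), simp_all add: \<Lambda>(2))
qed

lemma antisym_fields_diff:
  fixes v w :: "(real^'n) \<times> (real^'n) \<Rightarrow> real"
  assumes "v \<in> antisym_fields" "w \<in> antisym_fields"
  shows "(\<lambda>z. v z - w z) \<in> antisym_fields"
  unfolding antisym_fields_def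
proof (intro CollectI allI impI)
  fix x y :: "real^'n" assume "x \<noteq> y"
  then have "v (x, y) = - v (y, x)" "w (x, y) = - w (y, x)"
    using assms unfolding antisym_fields_def by blast+
  then show "v (x, y) - w (x, y) = - (v (y, x) - w (y, x))" by simp
qed

lemma flux_pairing_diff:
  fixes \<mu> :: "(real^'n) measure"
  assumes \<Phi>: "admissible_interp L \<Phi>" and \<mu>: "radon_measure \<mu>"
    and \<nu>: "\<nu> \<in> M_TV" and \<tau>: "\<tau> \<in> M_TV"
    and v: "v \<in> borel_measurable offdiag_borel" "v \<in> antisym_fields"
    and w: "w \<in> borel_measurable offdiag_borel" "w \<in> antisym_fields"
    and C: "C \<ge> 0" and C': "C' \<ge> 0"
    and v_bound: "\<And>x. (\<integral>\<^sup>+y\<in>UNIV - {x}. ennreal \<bar>v (x, y)\<bar> \<partial>\<mu>) \<le> ennreal C"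
    and w_bound: "\<And>x. (\<integral>\<^sup>+y\<in>UNIV - {x}. ennreal \<bar>w (x, y)\<bar> \<partial>\<mu>) \<le> ennreal C"
    and vw_bound: "\<And>x. (\<integral>\<^sup>+y\<in>UNIV - {x}. ennreal \<bar>v (x, y) - w (x, y)\<bar> \<partial>\<mu>) \<le> ennreal C'"
    and \<eta>: "\<eta> \<in> C_b_offdiag" and \<theta>: "\<theta> \<in> C_b_offdiag"
    and \<theta>_bound: "\<And>z. z \<in> offdiag \<Longrightarrow> \<bar>\<theta> z\<bar> \<le> E" and E: "E \<ge> 0"
    and \<eta>\<theta>_bound: "\<And>z. z \<in> offdiag \<Longrightarrow> \<bar>\<eta> z - \<theta> z\<bar> \<le> \<delta>" and \<delta>: "\<delta> \<ge> 0"
    and \<phi>: "continuous_on UNIV \<phi>" "\<And>x. \<bar>\<phi> x\<bar> \<le> 1"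
  shows "\<bar>signed_integral offdiag_borel (flux \<Phi> \<mu> \<eta> \<nu> v) (nl_grad \<phi>)
      - signed_integral offdiag_borel (flux \<Phi> \<mu> \<theta> \<tau> w) (nl_grad \<phi>)\<bar>
    \<le> 4 * L * (C * tv_norm \<nu> * \<delta> + E * (C * tv_norm (\<lambda>A. \<nu> A - \<tau> A) + C' * tv_norm \<tau>))"
proof -
  let ?\<sigma> = "\<lambda>A. \<nu> A - \<tau> A"
  note \<sigma> = M_TV_diff[OF \<nu> \<tau>]
  have m: "sets \<mu> = sets borel" using \<mu> by (simp add: radon_measure_def)
  note sb = sets_flux_base[OF m]
  \<comment> \<open>The base of \<open>?\<sigma>\<close> is included so that the density of the
    difference is taken over the same measure.\<close>
  define \<Lambda> where "\<Lambda> = measure_add (flux_base \<mu> \<nu>) (measure_add (flux_base \<mu> \<tau>) (flux_base \<mu> ?\<sigma>))"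
  have \<Lambda>: "sigma_finite_measure \<Lambda>" "sets \<Lambda> = sets borel"
    unfolding \<Lambda>_def using sb by (auto intro!: sigma_finite_measure_add sigma_finite_flux_base \<mu> \<nu> \<tau> \<sigma> simp: sets_pair_borel m)
  have ac: "absolutely_continuous \<Lambda> (flux_base \<mu> \<nu>)"
    "absolutely_continuous \<Lambda> (measure_add (flux_base \<mu> \<tau>) (flux_base \<mu> ?\<sigma>))"
    unfolding \<Lambda>_def by (rule absolutely_continuous_measure_add; simp add: sets_pair_borel m)+
  have ac': "absolutely_continuous (measure_add (flux_base \<mu> \<tau>) (flux_base \<mu> ?\<sigma>)) (flux_base \<mu> \<tau>)"
    "absolutely_continuous (measure_add (flux_base \<mu> \<tau>) (flux_base \<mu> ?\<sigma>)) (flux_base \<mu> ?\<sigma>)"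
    by (rule absolutely_continuous_measure_add; simp add: sets_pair_borel m)+
  note ac\<nu> = ac(1) and ac\<tau> = absolutely_continuous_trans[OF ac(2) ac'(1)]
    and ac\<sigma> = absolutely_continuous_trans[OF ac(2) ac'(2)]
  let ?N = "restrict_space \<Lambda> offdiag"
  let ?a1 = "fst_density \<Lambda> \<mu> \<nu>" and ?b1 = "snd_density \<Lambda> \<mu> \<nu>"
    and ?a2 = "fst_density \<Lambda> \<mu> \<tau>" and ?b2 = "snd_density \<Lambda> \<mu> \<tau>"
    and ?a3 = "fst_density \<Lambda> \<mu> ?\<sigma>" and ?b3 = "snd_density \<Lambda> \<mu> ?\<sigma>"
  have vwm: "(\<lambda>z. v z - w z) \<in> borel_measurable offdiag_borel" using v w by simp
  note W1 = weighted_density_bound[OF \<mu> \<nu> \<Lambda> ac\<nu> v v_bound C]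
    and W2 = weighted_density_bound[OF \<mu> \<tau> \<Lambda> ac\<tau> vwm antisym_fields_diff[OF v(2) w(2)] vw_bound C']
    and W3 = weighted_density_bound[OF \<mu> \<sigma> \<Lambda> ac\<sigma> v v_bound C]
  have \<psi>: "nl_grad \<phi> \<in> borel_measurable borel"
    unfolding nl_grad_def case_prod_beta
    by (intro borel_measurable_continuous_onI continuous_intros continuous_on_compose2[OF \<phi>(1)]) auto
  have \<psi>2: "\<bar>nl_grad \<phi> z\<bar> \<le> 2" for z
    using \<phi>(2)[of "fst z"] \<phi>(2)[of "snd z"] by (auto simp: nl_grad_def case_prod_beta abs_le_iff)
  let ?f1 = "flux_density \<Lambda> \<Phi> \<mu> \<eta> \<nu> v" and ?f2 = "flux_density \<Lambda> \<Phi> \<mu> \<theta> \<tau> w"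
  note F1 = signed_integral_flux[OF \<Phi> \<mu> \<nu> v v_bound C \<eta> \<Lambda> ac\<nu> \<psi> \<psi>2]
    and F2 = signed_integral_flux[OF \<Phi> \<mu> \<tau> w w_bound C \<theta> \<Lambda> ac\<tau> \<psi> \<psi>2]
  \<comment> \<open>The outer 2 bounds the nonlocal gradient of \<open>\<phi>\<close>, and each
    inner sum contains two densities; together they give the 4 in the claim.\<close>
  define G where "G z = 2 * (L * \<delta> * (\<bar>?a1 z\<bar> * \<bar>v z\<bar> + \<bar>?b1 z\<bar> * \<bar>v z\<bar>)
    + E * L * ((\<bar>?a3 z\<bar> * \<bar>v z\<bar> + \<bar>?b3 z\<bar> * \<bar>v z\<bar>) + (\<bar>?a2 z\<bar> * \<bar>v z - w z\<bar> + \<bar>?b2 z\<bar> * \<bar>v z - w z\<bar>)))" for z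
  note L = admissible_interp_pos[OF \<Phi>]
  have Gint: "integrable ?N G"
    unfolding G_def
    by (intro integrable_mult_right Bochner_Integration.integrable_add W1(1) W2(1) W3(1)) auto
  have "integral\<^sup>L ?N G = 2 * (L * \<delta> * ((\<integral>z. \<bar>?a1 z\<bar> * \<bar>v z\<bar> \<partial>?N) + (\<integral>z. \<bar>?b1 z\<bar> * \<bar>v z\<bar> \<partial>?N))
    + E * L * (((\<integral>z. \<bar>?a3 z\<bar> * \<bar>v z\<bar> \<partial>?N) + (\<integral>z. \<bar>?b3 z\<bar> * \<bar>v z\<bar> \<partial>?N))
      + ((\<integral>z. \<bar>?a2 z\<bar> * \<bar>v z - w z\<bar> \<partial>?N) + (\<integral>z. \<bar>?b2 z\<bar> * \<bar>v z - w z\<bar> \<partial>?N))))"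
    unfolding G_def by (simp add: W1(1) W2(1) W3(1))
  also have "\<dots> \<le> 2 * (L * \<delta> * (C * tv_norm \<nu> + C * tv_norm \<nu>)
    + E * L * ((C * tv_norm ?\<sigma> + C * tv_norm ?\<sigma>) + (C' * tv_norm \<tau> + C' * tv_norm \<tau>)))"
    using L \<delta> E by (intro mult_left_mono add_mono W1(2) W2(2) W3(2)) auto
  also have "\<dots> = 4 * L * (C * tv_norm \<nu> * \<delta> + E * (C * tv_norm ?\<sigma> + C' * tv_norm \<tau>))"
    by (simp add: algebra_simps)
  finally have Gle: "integral\<^sup>L ?N G \<le> 4 * L * (C * tv_norm \<nu> * \<delta> + E * (C * tv_norm ?\<sigma> + C' * tv_norm \<tau>))" .
  have pt: "AE z in ?N. \<bar>?f1 z * nl_grad \<phi> z - ?f2 z * nl_grad \<phi> z\<bar> \<le> G z"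
  proof -
    have "AE z in \<Lambda>. z \<in> offdiag \<longrightarrow> \<bar>?f1 z * nl_grad \<phi> z - ?f2 z * nl_grad \<phi> z\<bar> \<le> G z"
      using density_diff[OF \<mu> \<nu> \<tau> \<Lambda> ac\<nu> ac\<tau> ac\<sigma>]
    proof eventually_elim
      case (elim z)
      show ?case
      proof
        assume z: "z \<in> offdiag"
        let ?P = "\<Phi> (?a1 z) (?b1 z) (v z)" and ?Q = "\<Phi> (?a2 z) (?b2 z) (w z)"
        have "\<bar>?f1 z - ?f2 z\<bar> = \<bar>?P * (\<eta> z - \<theta> z) + (?P - ?Q) * \<theta> z\<bar>"
          by (simp add: flux_density_def algebra_simps)
        also have "\<dots> \<le> \<bar>?P\<bar> * \<bar>\<eta> z - \<theta> z\<bar> + \<bar>?P - ?Q\<bar> * \<bar>\<theta> z\<bar>"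
          by (rule order_trans[OF abs_triangle_ineq]) (simp add: abs_mult)
        also have "\<dots> \<le> (L * (\<bar>?a1 z\<bar> + \<bar>?b1 z\<bar>) * \<bar>v z\<bar>) * \<delta>
          + (L * ((\<bar>?a1 z - ?a2 z\<bar> + \<bar>?b1 z - ?b2 z\<bar>) * \<bar>v z\<bar> + (\<bar>?a2 z\<bar> + \<bar>?b2 z\<bar>) * \<bar>v z - w z\<bar>)) * E"
          using L \<theta>_bound[OF z] \<eta>\<theta>_bound[OF z]
          by (intro add_mono mult_mono admissible_interp_bound[OF \<Phi>] admissible_interp_diff[OF \<Phi>]) auto
        \<comment> \<open>This is where the differences of densities become \<open>?a3\<close> and
          \<open>?b3\<close>, whose integrals involve the norm of \<open>?\<sigma>\<close>.\<close>
        also have "\<dots> = G z / 2" by (simp only: G_def elim(1,2)) (simp add: algebra_simps)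
        finally have le: "\<bar>?f1 z - ?f2 z\<bar> \<le> G z / 2" .
        have "\<bar>?f1 z - ?f2 z\<bar> * \<bar>nl_grad \<phi> z\<bar> \<le> G z / 2 * 2"
          using order_trans[OF abs_ge_zero le] by (intro mult_mono le \<psi>2) auto
        then show "\<bar>?f1 z * nl_grad \<phi> z - ?f2 z * nl_grad \<phi> z\<bar> \<le> G z"
          by (simp add: abs_mult[symmetric] left_diff_distrib)
      qed
    qed
    then show ?thesis
      using \<Lambda>(2) by (subst AE_restrict_space_iff) (auto simp: sets_eq_imp_space_eq[OF \<Lambda>(2)])
  qed
  have "\<bar>signed_integral offdiag_borel (flux \<Phi> \<mu> \<eta> \<nu> v) (nl_grad \<phi>)
      - signed_integral offdiag_borel (flux \<Phi> \<mu> \<theta> \<tau> w) (nl_grad \<phi>)\<bar>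
    = \<bar>\<integral>z. ?f1 z * nl_grad \<phi> z - ?f2 z * nl_grad \<phi> z \<partial>?N\<bar>"
    using F1 F2 by simp
  also have "\<dots> \<le> (\<integral>z. \<bar>?f1 z * nl_grad \<phi> z - ?f2 z * nl_grad \<phi> z\<bar> \<partial>?N)"
    by (rule integral_abs_bound)
  also have "\<dots> \<le> integral\<^sup>L ?N G"
    using F1(2) F2(2) by (intro integral_mono_AE pt Gint) auto
  finally show ?thesis using Gle by simp
qed

section \<open>Absolutely continuous curves\<close>

lemma continuous_on_set_lebesgue_integral:
  fixes f :: "real \<Rightarrow> real"
  assumes f: "set_integrable lebesgue {a..b} f"
  shows "continuous_on {a..b} (\<lambda>t. LINT r:{a..t}|lebesgue. f r)"
proof -
  have eq: "(LINT r:{a..t}|lebesgue. f r) = integral {a..t} f" if "t \<in> {a..b}" for t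
    using that by (intro set_lebesgue_integral_eq_integral(2) set_integrable_subset[OF f]) auto
  have "continuous_on {a..b} (\<lambda>t. integral {a..t} f)"
    by (intro indefinite_integral_continuous_1 set_lebesgue_integral_eq_integral(1) f)
  then show ?thesis by (subst continuous_on_cong[OF refl eq])
qed

lemma set_lebesgue_integral_split:
  fixes f :: "real \<Rightarrow> real"
  assumes f: "set_integrable lebesgue {a..b} f" and "a \<le> s" "s \<le> t" "t \<le> b"
  shows "(LINT r:{s..t}|lebesgue. f r) = (LINT r:{a..t}|lebesgue. f r) - (LINT r:{a..s}|lebesgue. f r)"
proof -
  have int: "set_integrable lebesgue {c..d} f" if "{c..d} \<subseteq> {a..b}" for c d
    using that by (intro set_integrable_subset[OF f]) auto
  have i: "set_integrable lebesgue {s..t} f" "set_integrable lebesgue {a..t} f" "set_integrable lebesgue {a..s} f"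
    using assms by (auto intro!: int)
  have "integral {a..s} f + integral {s..t} f = integral {a..t} f"
    by (intro Henstock_Kurzweil_Integration.integral_combine assms set_lebesgue_integral_eq_integral(1) i)
  then show ?thesis by (simp add: set_lebesgue_integral_eq_integral(2) i)
qed

text \<open>Increments of \<open>u\<close> are dominated by those of the primitive of
  \<open>m\<close>, which is continuous.\<close>

lemma continuous_on_AC_modulus:
  fixes u m :: "real \<Rightarrow> real"
  assumes m: "set_integrable lebesgue {0..T} m"
    and le: "\<And>s t. 0 \<le> s \<Longrightarrow> s < t \<Longrightarrow> t \<le> T \<Longrightarrow> \<bar>u t - u s\<bar> \<le> (LINT r:{s..t}|lebesgue. m r)"
  shows "continuous_on {0..T} u"
proof -
  define F where "F t = (LINT r:{0..t}|lebesgue. m r)" for t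
  have F: "continuous_on {0..T} F"
    unfolding F_def by (rule continuous_on_set_lebesgue_integral[OF m])
  have lt: "\<bar>u t - u s\<bar> \<le> \<bar>F t - F s\<bar>" if "0 \<le> s" "s < t" "t \<le> T" for s t
    using le[OF that] that unfolding F_def
    by (subst (asm) set_lebesgue_integral_split[OF m]) auto
  have "dist (u t) (u s) \<le> dist (F t) (F s)" if "s \<in> {0..T}" "t \<in> {0..T}" for s t
    using lt[of s t] lt[of t s] that by (cases s t rule: linorder_cases) (auto simp: dist_real_def abs_minus_commute)
  then show ?thesis
    using F unfolding continuous_on_iff by (meson le_less_trans)
qed

text \<open>The set of equality is closed. A closed set that contains almost every point of an open
  interval contains all of it, and the endpoints follow by closure. This turns the almost-everywhere
  equations into equations at every time.\<close>

lemma AE_eq_continuous_on: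
  fixes u v :: "real \<Rightarrow> real"
  assumes T: "T > 0" and u: "continuous_on {0..T} u" and v: "continuous_on {0..T} v"
    and ae: "AE t\<in>{0..T} in lebesgue. u t = v t" and t: "t \<in> {0..T}"
  shows "u t = v t"
proof -
  define C where "C = {t \<in> {0..T}. u t - v t = 0}"
  have C: "closed C"
    unfolding C_def by (intro continuous_closed_preimage_constant continuous_intros u v)
  have "s \<in> C" if "s \<in> {0<..<T}" for s
  proof (rule mem_closed_if_AE_lebesgue_open[OF _ C _ that])
    show "AE t\<in>{0<..<T} in lebesgue. t \<in> C"
      using ae by eventually_elim (auto simp: C_def)
  qed simp
  then have "closure {0<..<T} \<subseteq> C" using C by (intro closure_minimal) auto
  then have "t \<in> C" using T t by (auto simp: closure_greaterThanLessThan)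
  then show ?thesis by (simp add: C_def)
qed

section \<open>Integral inequalities in time\<close>

lemma abs_set_lebesgue_integral_le:
  fixes f G :: "real \<Rightarrow> real"
  assumes f: "set_integrable lebesgue {a..b} f" and ab: "a \<le> b"
    and G: "\<And>s. s \<in> {a..b} \<Longrightarrow> (G has_real_derivative g s) (at s)" "continuous_on {a..b} g"
    and le: "\<And>s. s \<in> {a..b} \<Longrightarrow> \<bar>f s\<bar> \<le> g s"
  shows "\<bar>LINT s:{a..b}|lebesgue. f s\<bar> \<le> G b - G a"
proof -
  have g: "(g has_integral G b - G a) {a..b}"
    using ab G(1) by (intro fundamental_theorem_of_calculus)
      (auto simp: has_real_derivative_iff_has_vector_derivative[symmetric] intro: has_field_derivative_at_within)
  have "norm (integral {a..b} f) \<le> integral {a..b} g"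
    using le by (intro integral_norm_bound_integral set_lebesgue_integral_eq_integral(1) f has_integral_integrable[OF g]) auto
  then show ?thesis
    using integral_unique[OF g] by (simp add: set_lebesgue_integral_eq_integral(2)[OF f])
qed

text \<open>The hypothesis \<open>step\<close> is what \<open>g t \<le> D + b \<integral>\<^sub>0\<^sup>t g\<close> yields with \<open>g\<close> replaced by the majorant \<open>G exp (2 b s)\<close>, which avoids measurability of \<open>g\<close>.\<close>

lemma gronwall_weighted:
  fixes g :: "real \<Rightarrow> real"
  assumes b: "b \<ge> 0" and T: "T \<ge> 0" and bdd: "\<And>t. t \<in> {0..T} \<Longrightarrow> g t \<le> K" and D: "D \<ge> 0"
    and step: "\<And>G t. (\<And>s. s \<in> {0..T} \<Longrightarrow> g s \<le> G * exp (2 * b * s)) \<Longrightarrow> t \<in> {0..T} \<Longrightarrow>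
      g t \<le> D + G * exp (2 * b * t) / 2"
    and t: "t \<in> {0..T}"
  shows "g t \<le> 2 * D * exp (2 * b * T)"
proof -
  \<comment> \<open>Rate \<open>2 * b\<close> is chosen because \<open>b\<close> times the integral
    of \<open>exp (2 * b * s)\<close> over \<open>[0,t]\<close> is at most half of
    \<open>exp (2 * b * t)\<close>, which is the factor 1/2 in \<open>step\<close>.\<close>
  define h where "h t = g t * exp (- (2 * b * t))" for t
  have h: "g s = h s * exp (2 * b * s)" for s
    by (simp add: h_def mult.assoc exp_add[symmetric])
  have bddh: "bdd_above (h ` {0..T})"
  proof (rule bdd_aboveI2)
    fix s assume s: "s \<in> {0..T}"
    have "h s \<le> \<bar>K\<bar> * exp (- (2 * b * s))"
      using bdd[OF s] unfolding h_def by (intro mult_right_mono) auto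
    also have "\<dots> \<le> \<bar>K\<bar> * 1" using b s by (intro mult_left_mono) auto
    finally show "h s \<le> \<bar>K\<bar>" by simp
  qed
  define G where "G = (SUP s\<in>{0..T}. h s)"
  have hG: "h s \<le> G" if "s \<in> {0..T}" for s
    unfolding G_def using that by (intro cSUP_upper bddh)
  have le: "h s \<le> D + G / 2" if s: "s \<in> {0..T}" for s
  proof -
    have "g s \<le> D + G * exp (2 * b * s) / 2"
      using s by (intro step) (auto simp: h hG)
    then have "h s \<le> (D + G * exp (2 * b * s) / 2) * exp (- (2 * b * s))"
      unfolding h_def by (intro mult_right_mono) auto
    also have "\<dots> = D * exp (- (2 * b * s)) + G / 2"
      by (simp add: distrib_right mult.assoc exp_add[symmetric])
    also have "\<dots> \<le> D * 1 + G / 2" using b s D by (intro add_mono mult_left_mono) auto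
    finally show ?thesis by simp
  qed
  \<comment> \<open>\<open>G\<close> is a genuine real supremum by \<open>bddh\<close>, so
    \<open>G / 2\<close> can be absorbed.\<close>
  have "G \<le> D + G / 2" unfolding G_def using T by (intro cSUP_least le[unfolded G_def]) auto
  then have "h t \<le> 2 * D" using hG[OF t] by linarith
  then have "g t \<le> 2 * D * exp (2 * b * t)" unfolding h by (intro mult_right_mono) auto
  also have "\<dots> \<le> 2 * D * exp (2 * b * T)" using b t D by (intro mult_left_mono) (auto intro: mult_left_mono)
  finally show ?thesis .
qed

section \<open>The slow variable\<close>

lemma offdiag_nonempty: "(offdiag :: ((real^'n) \<times> (real^'n)) set) \<noteq> {}"
proof -
  \<comment> \<open>Index types are nonempty, so some axis vector exists and differs from 0.
    Nonemptiness matters because \<open>sup_norm_offdiag\<close> is a supremum of reals.\<close>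
  have "(0, axis undefined 1) \<in> (offdiag :: ((real^'n) \<times> (real^'n)) set)"
    by (simp add: offdiag_def axis_eq_0_iff eq_commute[of 0])
  then show ?thesis by blast
qed

lemma abs_le_sup_norm_offdiag:
  assumes "f \<in> C_b_offdiag" "g \<in> C_b_offdiag" "z \<in> offdiag"
  shows "\<bar>f z - g z\<bar> \<le> sup_norm_offdiag (\<lambda>z. f z - g z)"
proof -
  obtain A B where "\<And>z. z \<in> offdiag \<Longrightarrow> \<bar>f z\<bar> \<le> A" "\<And>z. z \<in> offdiag \<Longrightarrow> \<bar>g z\<bar> \<le> B"
    using assms(1,2) by (force simp: C_b_offdiag_def bounded_iff)
  then have "\<bar>f z - g z\<bar> \<le> A + B" if "z \<in> offdiag" for z
    using that by (smt (verit))
  then have "bdd_above ((\<lambda>z. \<bar>f z - g z\<bar>) ` offdiag)" by (intro bdd_aboveI2) auto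
  from cSUP_upper[OF assms(3) this] show ?thesis by (simp add: sup_norm_offdiag_def)
qed

lemma sup_norm_offdiag_le:
  fixes f :: "(real^'n) \<times> (real^'n) \<Rightarrow> real"
  shows "(\<And>z. z \<in> offdiag \<Longrightarrow> \<bar>f z\<bar> \<le> c) \<Longrightarrow> sup_norm_offdiag f \<le> c"
  unfolding sup_norm_offdiag_def by (intro cSUP_least offdiag_nonempty) auto

text \<open>The integrand is at most \<open>A + E + K\<close>, with \<open>K\<close> the supremum of
  the deviation over all times and points at once. Absorbing \<open>K / 2\<close> accounts for the
  factor 2 in the constant.\<close>

lemma slow_variable_bound:
  fixes \<eta> a :: "real \<Rightarrow> (real^'n) \<times> (real^'n) \<Rightarrow> real"
  assumes T: "T > 0" and \<epsilon>: "\<epsilon> > 0" "\<epsilon> * T \<le> 1 / 2"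
    and AC: "AC_curve sup_norm_offdiag C_b_offdiag T \<eta>"
    and int: "\<And>z. z \<in> offdiag \<Longrightarrow> set_integrable lebesgue {0..T} (\<lambda>t. \<epsilon> * (a t z - \<eta> t z))"
    and ae: "AE t\<in>{0..T} in lebesgue. \<forall>z\<in>offdiag. \<eta> t z = \<eta> 0 z + \<epsilon> * (LINT s:{0..t}|lebesgue. a s z - \<eta> s z)"
    and a: "\<And>t z. t \<in> {0..T} \<Longrightarrow> z \<in> offdiag \<Longrightarrow> \<bar>a t z\<bar> \<le> A"
    and E: "\<And>z. z \<in> offdiag \<Longrightarrow> \<bar>\<eta> 0 z\<bar> \<le> E"
    and t: "t \<in> {0..T}" and z: "z \<in> offdiag"
  shows "\<bar>\<eta> t z - \<eta> 0 z\<bar> \<le> 2 * T * (A + E) * \<epsilon>"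
proof -
  obtain m where m: "set_integrable lebesgue {0..T} m"
    and mle: "\<And>s t. 0 \<le> s \<Longrightarrow> s < t \<Longrightarrow> t \<le> T \<Longrightarrow> sup_norm_offdiag (\<lambda>z. \<eta> t z - \<eta> s z) \<le> (LINT r:{s..t}|lebesgue. m r)"
    using AC unfolding AC_curve_def by blast
  have Cb: "\<eta> t \<in> C_b_offdiag" if "t \<in> {0..T}" for t using AC that unfolding AC_curve_def by blast
  have ptle: "\<bar>\<eta> t z - \<eta> s z\<bar> \<le> (LINT r:{s..t}|lebesgue. m r)"
    if "z \<in> offdiag" "0 \<le> s" "s < t" "t \<le> T" for z s t
    using that by (intro order_trans[OF abs_le_sup_norm_offdiag mle] Cb) auto
  have int': "set_integrable lebesgue {0..T} (\<lambda>t. a t z - \<eta> t z)" if "z \<in> offdiag" for z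
    using int[OF that] \<epsilon>(1) by simp
  \<comment> \<open>The exceptional set of times in \<open>ae\<close> is common to all points, but
    pointwise continuity in time is still needed to reach every \<open>t\<close>.\<close>
  have eq: "\<eta> t z = \<eta> 0 z + \<epsilon> * (LINT s:{0..t}|lebesgue. a s z - \<eta> s z)"
    if t: "t \<in> {0..T}" and z: "z \<in> offdiag" for t z
  proof (rule AE_eq_continuous_on[OF T _ _ _ t])
    show "continuous_on {0..T} (\<lambda>t. \<eta> t z)"
      by (rule continuous_on_AC_modulus[OF m ptle[OF z]])
    show "continuous_on {0..T} (\<lambda>t. \<eta> 0 z + \<epsilon> * (LINT s:{0..t}|lebesgue. a s z - \<eta> s z))"
      by (intro continuous_intros continuous_on_set_lebesgue_integral int' z)
    show "AE t\<in>{0..T} in lebesgue. \<eta> t z = \<eta> 0 z + \<epsilon> * (LINT s:{0..t}|lebesgue. a s z - \<eta> s z)"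
      using ae by eventually_elim (use z in blast)
  qed
  let ?d = "\<lambda>(t, z). \<bar>\<eta> t z - \<eta> 0 z\<bar>" and ?X = "{0..T} \<times> (offdiag :: ((real^'n) \<times> (real^'n)) set)"
  have cont: "continuous_on {0..T} (\<lambda>t. LINT r:{0..t}|lebesgue. m r)"
    by (rule continuous_on_set_lebesgue_integral[OF m])
  obtain K0 where K0: "\<And>t. t \<in> {0..T} \<Longrightarrow> \<bar>LINT r:{0..t}|lebesgue. m r\<bar> \<le> K0"
    using compact_imp_bounded[OF compact_continuous_image[OF cont]] by (force simp: bounded_iff)
  have "?d x \<le> max 0 K0" if "x \<in> ?X" for x
  proof -
    obtain t z where Pair: "x = (t, z)" by (rule prod.exhaust)
    then have tz: "t \<in> {0..T}" "z \<in> offdiag" using that by auto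
    \<comment> \<open>The modulus is available only for strictly increasing pairs of times, hence
      the separate case \<open>t = 0\<close>.\<close>
    then show ?thesis
      using ptle[of z 0 t] K0[of t] Pair by (cases "t = 0") auto
  qed
  then have bdd: "bdd_above (?d ` ?X)" by (rule bdd_aboveI2)
  define K where "K = (SUP x\<in>?X. ?d x)"
  have dK: "\<bar>\<eta> t z - \<eta> 0 z\<bar> \<le> K" if "t \<in> {0..T}" "z \<in> offdiag" for t z
    unfolding K_def using cSUP_upper[OF _ bdd, of "(t, z)"] that by simp
  have "?d x \<le> \<epsilon> * T * (A + E) + K / 2" if "x \<in> ?X" for x
  proof -
    obtain t z where Pair: "x = (t, z)" by (rule prod.exhaust)
    then have t: "t \<in> {0..T}" and z: "z \<in> offdiag" using that by auto
    have K: "K \<ge> 0" using dK[OF t z] by linarith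
    have AE0: "A + E \<ge> 0" using a[OF t z] E[OF z] by linarith
    have "\<bar>LINT s:{0..t}|lebesgue. a s z - \<eta> s z\<bar> \<le> (A + E + K) * t - (A + E + K) * 0"
    proof (rule abs_set_lebesgue_integral_le)
      show "set_integrable lebesgue {0..t} (\<lambda>s. a s z - \<eta> s z)"
        using t by (intro set_integrable_subset[OF int'[OF z]]) auto
      show "\<bar>a s z - \<eta> s z\<bar> \<le> A + E + K" if "s \<in> {0..t}" for s
        using that t a[of s z] E[of z] dK[of s z] z by auto
    qed (use t in \<open>auto intro!: derivative_eq_intros\<close>)
    also have "\<dots> \<le> (A + E + K) * T" using t K AE0 by (auto intro!: mult_left_mono)
    finally have "\<epsilon> * \<bar>LINT s:{0..t}|lebesgue. a s z - \<eta> s z\<bar> \<le> \<epsilon> * ((A + E + K) * T)"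
      using \<epsilon>(1) by (intro mult_left_mono) auto
    also have "\<dots> = \<epsilon> * T * (A + E) + \<epsilon> * T * K" by (simp add: algebra_simps)
    also have "\<dots> \<le> \<epsilon> * T * (A + E) + 1 / 2 * K" using mult_right_mono[OF \<epsilon>(2) K] by simp
    finally show ?thesis using eq[OF t z] \<epsilon>(1) Pair by (simp add: abs_mult)
  qed
  then have "K \<le> \<epsilon> * T * (A + E) + K / 2"
    unfolding K_def using T offdiag_nonempty by (intro cSUP_least) auto
  then show ?thesis using dK[OF t z] by (simp add: algebra_simps)
qed

section \<open>Stability of the transport equation\<close>

lemma M_TV_le_D: "\<sigma> \<in> M_TV_le M \<Longrightarrow> \<sigma> \<in> M_TV" "\<sigma> \<in> M_TV_le M \<Longrightarrow> tv_norm \<sigma> \<le> M"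
  by (auto simp: M_TV_le_def)

lemma C_zero_D:
  assumes "\<phi> \<in> C_zero"
  shows "continuous_on UNIV \<phi>" "\<phi> \<in> borel_measurable borel"
  using assms by (auto simp: C_zero_def intro: borel_measurable_continuous_onI)

lemma continuous_on_signed_integral:
  fixes \<rho> :: "real \<Rightarrow> (real^'n) set \<Rightarrow> real"
  assumes AC: "AC_curve tv_norm (M_TV_le M) T \<rho>" and \<phi>: "\<phi> \<in> C_zero" "\<And>x. \<bar>\<phi> x\<bar> \<le> 1"
  shows "continuous_on {0..T} (\<lambda>t. signed_integral borel (\<rho> t) \<phi>)"
proof -
  obtain m where m: "set_integrable lebesgue {0..T} m"
    and mle: "\<And>s t. 0 \<le> s \<Longrightarrow> s < t \<Longrightarrow> t \<le> T \<Longrightarrow> tv_norm (\<lambda>A. \<rho> t A - \<rho> s A) \<le> (LINT r:{s..t}|lebesgue. m r)"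
    using AC unfolding AC_curve_def by blast
  show ?thesis
  proof (rule continuous_on_AC_modulus[OF m])
    fix s t assume st: "0 \<le> s" "s < t" "t \<le> T"
    have tv: "\<rho> s \<in> M_TV" "\<rho> t \<in> M_TV" using AC st by (auto simp: AC_curve_def M_TV_le_def)
    note \<phi>' = C_zero_D(2)[OF \<phi>(1)] \<phi>(2)
    have "\<bar>signed_integral borel (\<rho> t) \<phi> - signed_integral borel (\<rho> s) \<phi>\<bar> \<le> 1 * tv_norm (\<lambda>A. \<rho> t A - \<rho> s A)"
      unfolding signed_integral_diff[OF tv(2,1) \<phi>', symmetric]
      by (rule signed_integral_bound[OF M_TV_diff[OF tv(2,1)] \<phi>'])
    then show "\<bar>signed_integral borel (\<rho> t) \<phi> - signed_integral borel (\<rho> s) \<phi>\<bar> \<le> (LINT r:{s..t}|lebesgue. m r)"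
      using mle[OF st] by simp
  qed
qed

lemma tv_norm_le_bounded:
  assumes "\<nu> \<in> M_TV_le M" "\<tau> \<in> M_TV_le M"
  shows "tv_norm (\<lambda>A. \<nu> A - \<tau> A) \<le> 2 * M"
  using tv_norm_diff_le[of \<nu> \<tau>] assms by (auto simp: M_TV_le_def)

text \<open>The discrepancy \<open>\<delta>\<close> of the slow variables acts as a forcing term,
  and the distance of the curves feeds back linearly through densities and velocities. Each test
  function is handled separately and the norm is recovered only after integrating in time, so
  \<open>g\<close> is never integrated itself.\<close>

lemma transport_stability:
  fixes \<mu> :: "(real^'n) measure" and \<rho> \<sigma> :: "real \<Rightarrow> (real^'n) set \<Rightarrow> real"
  assumes T: "T > 0" and M: "M \<ge> 0" and \<Phi>: "admissible_interp L \<Phi>" and \<mu>: "radon_measure \<mu>"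
    and V: "\<And>t \<nu>. t \<in> {0..T} \<Longrightarrow> \<nu> \<in> M_TV_le M \<Longrightarrow> V t \<nu> \<in> antisym_fields"
      "\<And>t \<nu>. t \<in> {0..T} \<Longrightarrow> \<nu> \<in> M_TV_le M \<Longrightarrow> V t \<nu> \<in> borel_measurable offdiag_borel"
    and C: "C \<ge> 0" and L': "L' \<ge> 0"
    and V_bound: "\<And>t \<nu> x. t \<in> {0..T} \<Longrightarrow> \<nu> \<in> M_TV_le M \<Longrightarrow>
      (\<integral>\<^sup>+y\<in>UNIV - {x}. ennreal \<bar>V t \<nu> (x, y)\<bar> \<partial>\<mu>) \<le> ennreal C"
    and V_lip: "\<And>t \<nu> \<tau> x. t \<in> {0..T} \<Longrightarrow> \<nu> \<in> M_TV_le M \<Longrightarrow> \<tau> \<in> M_TV_le M \<Longrightarrow>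
      (\<integral>\<^sup>+y\<in>UNIV - {x}. ennreal \<bar>V t \<nu> (x, y) - V t \<tau> (x, y)\<bar> \<partial>\<mu>)
        \<le> ennreal (L' * tv_norm (\<lambda>A. \<nu> A - \<tau> A))"
    and \<rho>: "AC_curve tv_norm (M_TV_le M) T \<rho>" and \<sigma>: "AC_curve tv_norm (M_TV_le M) T \<sigma>"
    and init: "\<rho> 0 = \<sigma> 0"
    and \<eta>: "\<And>t. t \<in> {0..T} \<Longrightarrow> \<eta> t \<in> C_b_offdiag" and \<theta>: "\<theta> \<in> C_b_offdiag"
    and \<theta>_bound: "\<And>z. z \<in> offdiag \<Longrightarrow> \<bar>\<theta> z\<bar> \<le> E" and E: "E \<ge> 0"
    and \<eta>\<theta>: "\<And>t z. t \<in> {0..T} \<Longrightarrow> z \<in> offdiag \<Longrightarrow> \<bar>\<eta> t z - \<theta> z\<bar> \<le> \<delta>" and \<delta>: "\<delta> \<ge> 0"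
    and int\<rho>: "\<And>\<phi>. \<phi> \<in> C_zero \<Longrightarrow> set_integrable lebesgue {0..T}
      (\<lambda>t. nl_div_pairing \<phi> (flux \<Phi> \<mu> (\<eta> t) (\<rho> t) (V t (\<rho> t))))"
    and int\<sigma>: "\<And>\<phi>. \<phi> \<in> C_zero \<Longrightarrow> set_integrable lebesgue {0..T}
      (\<lambda>t. nl_div_pairing \<phi> (flux \<Phi> \<mu> \<theta> (\<sigma> t) (V t (\<sigma> t))))"
    and eq\<rho>: "\<And>\<phi>. \<phi> \<in> C_zero \<Longrightarrow> AE t\<in>{0..T} in lebesgue.
      signed_integral borel (\<rho> t) \<phi> = signed_integral borel (\<rho> 0) \<phi> + 1/2 * (LINT s:{0..t}|lebesgue.
        signed_integral offdiag_borel (flux \<Phi> \<mu> (\<eta> s) (\<rho> s) (V s (\<rho> s))) (nl_grad \<phi>))"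
    and eq\<sigma>: "\<And>\<phi>. \<phi> \<in> C_zero \<Longrightarrow> AE t\<in>{0..T} in lebesgue.
      signed_integral borel (\<sigma> t) \<phi> = signed_integral borel (\<sigma> 0) \<phi> + 1/2 * (LINT s:{0..t}|lebesgue.
        signed_integral offdiag_borel (flux \<Phi> \<mu> \<theta> (\<sigma> s) (V s (\<sigma> s))) (nl_grad \<phi>))"
    and t: "t \<in> {0..T}"
  shows "tv_norm (\<lambda>A. \<rho> t A - \<sigma> t A) \<le> 4 * L * C * M * T * exp (4 * L * E * (C + L' * M) * T) * \<delta>"
proof -
  \<comment> \<open>With the factor 1/2 of the weak equation, \<open>a\<close> and \<open>b\<close>
    are the coefficients of \<open>\<delta>\<close> and of \<open>g s\<close> in the time integrand,
    once both norms in \<open>flux_pairing_diff\<close> are bounded by \<open>M\<close>.\<close>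
  define a where "a = 2 * L * C * M"
  define b where "b = 2 * L * E * (C + L' * M)"
  define g where "g t = tv_norm (\<lambda>A. \<rho> t A - \<sigma> t A)" for t
  note L = admissible_interp_pos[OF \<Phi>]
  have a: "a \<ge> 0" and b: "b \<ge> 0" using L C M E L' by (auto simp: a_def b_def)
  have \<rho>M: "\<rho> s \<in> M_TV_le M" and \<sigma>M: "\<sigma> s \<in> M_TV_le M" if "s \<in> {0..T}" for s
    using \<rho> \<sigma> that by (auto simp: AC_curve_def)
  have g0: "g s \<ge> 0" for s by (simp add: g_def tv_norm_nonneg)
  have "g t \<le> 2 * (a * T * \<delta>) * exp (2 * b * T)"
  proof (rule gronwall_weighted[OF b _ _ _ _ t])
    show "g s \<le> 2 * M" if "s \<in> {0..T}" for s
      unfolding g_def by (rule tv_norm_le_bounded[OF \<rho>M[OF that] \<sigma>M[OF that]])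
    show "0 \<le> a * T * \<delta>" using a T \<delta> by simp
    fix G t assume G: "\<And>s. s \<in> {0..T} \<Longrightarrow> g s \<le> G * exp (2 * b * s)" and t: "t \<in> {0..T}"
    show "g t \<le> a * T * \<delta> + G * exp (2 * b * t) / 2"
      unfolding g_def
    proof (rule tv_norm_le_dual)
      show "(\<lambda>A. \<rho> t A - \<sigma> t A) \<in> M_TV"
        by (intro M_TV_diff M_TV_le_D(1)[OF \<rho>M] M_TV_le_D(1)[OF \<sigma>M] t)
      fix \<phi> :: "real^'n \<Rightarrow> real" assume \<phi>: "\<phi> \<in> C_zero" "\<And>x. \<bar>\<phi> x\<bar> \<le> 1"
      define p where "p s = signed_integral offdiag_borel (flux \<Phi> \<mu> (\<eta> s) (\<rho> s) (V s (\<rho> s))) (nl_grad \<phi>)" for s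
      define q where "q s = signed_integral offdiag_borel (flux \<Phi> \<mu> \<theta> (\<sigma> s) (V s (\<sigma> s))) (nl_grad \<phi>)" for s
      have p: "set_integrable lebesgue {0..T} p" and q: "set_integrable lebesgue {0..T} q"
        using int\<rho>[OF \<phi>(1)] int\<sigma>[OF \<phi>(1)]
        unfolding nl_div_pairing_def p_def[symmetric] q_def[symmetric]
        by (simp_all only: set_integrable_mult_right_iff)
      have p': "set_integrable lebesgue {0..t} p" and q': "set_integrable lebesgue {0..t} q"
        using t by (auto intro: set_integrable_subset[OF p] set_integrable_subset[OF q])
      \<comment> \<open>\<open>\<phi>\<close> is fixed here, so its own null set of times can be
        removed by continuity of both sides.\<close>
      have all: "signed_integral borel (r t) \<phi> = signed_integral borel (r 0) \<phi> + 1/2 * (LINT s:{0..t}|lebesgue. h s)"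
        if "AC_curve tv_norm (M_TV_le M) T r" "set_integrable lebesgue {0..T} h"
          "AE t\<in>{0..T} in lebesgue. signed_integral borel (r t) \<phi>
            = signed_integral borel (r 0) \<phi> + 1/2 * (LINT s:{0..t}|lebesgue. h s)" for r h
        by (rule AE_eq_continuous_on[OF T _ _ that(3) t])
          (intro continuous_intros continuous_on_signed_integral[OF that(1)] \<phi> continuous_on_set_lebesgue_integral that(2))+
      have pq: "\<bar>p s - q s\<bar> \<le> 2 * (a * \<delta> + b * G * exp (2 * b * s))" if s: "s \<in> {0..T}" for s
      proof -
        note R = \<rho>M[OF s] and S = \<sigma>M[OF s]
        have "\<bar>p s - q s\<bar> \<le> 4 * L * (C * tv_norm (\<rho> s) * \<delta> + E * (C * g s + L' * g s * tv_norm (\<sigma> s)))"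
          unfolding p_def q_def g_def
          by (rule flux_pairing_diff[OF \<Phi> \<mu> M_TV_le_D(1)[OF R] M_TV_le_D(1)[OF S]
                V(2)[OF s R] V(1)[OF s R] V(2)[OF s S] V(1)[OF s S] C _ V_bound[OF s R] V_bound[OF s S] V_lip[OF s R S]
                \<eta>[OF s] \<theta> \<theta>_bound E \<eta>\<theta>[OF s] \<delta> C_zero_D(1)[OF \<phi>(1)] \<phi>(2)])
            (use L' in \<open>simp add: tv_norm_nonneg\<close>)
        also have "\<dots> \<le> 4 * L * (C * M * \<delta> + E * (C * g s + L' * g s * M))"
          using L C E L' \<delta> g0[of s] M_TV_le_D(2)[OF R] M_TV_le_D(2)[OF S]
          by (intro mult_left_mono add_mono mult_right_mono) auto
        also have "\<dots> = 2 * (a * \<delta> + b * g s)" by (simp add: a_def b_def algebra_simps)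
        also have "\<dots> \<le> 2 * (a * \<delta> + b * (G * exp (2 * b * s)))"
          using b G[OF s] by (intro mult_left_mono add_left_mono) auto
        finally show ?thesis by (simp add: mult.assoc)
      qed
      \<comment> \<open>Nonnegativity of \<open>G\<close> allows the contribution of the primitive
        \<open>G * exp (2 * b * s)\<close> at \<open>s = 0\<close> to be dropped below.\<close>
      have G0: "G \<ge> 0"
        using order_trans[OF g0 G[of 0]] T by simp
      have le: "\<bar>LINT s:{0..t}|lebesgue. p s - q s\<bar>
          \<le> (2 * (a * \<delta>) * t + G * exp (2 * b * t)) - (2 * (a * \<delta>) * 0 + G * exp (2 * b * 0))"
      proof (rule abs_set_lebesgue_integral_le[where g="\<lambda>s. 2 * (a * \<delta> + b * G * exp (2 * b * s))"])
        show "set_integrable lebesgue {0..t} (\<lambda>s. p s - q s)" using p' q' by simp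
        show "\<bar>p s - q s\<bar> \<le> 2 * (a * \<delta> + b * G * exp (2 * b * s))" if "s \<in> {0..t}" for s
          using that t by (intro pq) auto
        show "((\<lambda>s. 2 * (a * \<delta>) * s + G * exp (2 * b * s)) has_real_derivative 2 * (a * \<delta> + b * G * exp (2 * b * s))) (at s)" for s
          by (auto intro!: derivative_eq_intros simp: algebra_simps)
        show "continuous_on {0..t} (\<lambda>s. 2 * (a * \<delta> + b * G * exp (2 * b * s)))"
          by (intro continuous_intros)
      qed (use t in auto)
      have "signed_integral borel (\<lambda>A. \<rho> t A - \<sigma> t A) \<phi> = signed_integral borel (\<rho> t) \<phi> - signed_integral borel (\<sigma> t) \<phi>"
        by (rule signed_integral_diff[OF M_TV_le_D(1)[OF \<rho>M[OF t]] M_TV_le_D(1)[OF \<sigma>M[OF t]] C_zero_D(2)[OF \<phi>(1)] \<phi>(2)])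
      also have "\<dots> = 1/2 * (LINT s:{0..t}|lebesgue. p s) - 1/2 * (LINT s:{0..t}|lebesgue. q s)"
        using all[OF \<rho> p] all[OF \<sigma> q] eq\<rho>[OF \<phi>(1)] eq\<sigma>[OF \<phi>(1)] by (simp add: p_def q_def init)
      also have "\<dots> = 1/2 * (LINT s:{0..t}|lebesgue. p s - q s)"
        using p' q' by (simp add: set_integral_diff right_diff_distrib)
      also have "\<dots> \<le> a * \<delta> * t + G * exp (2 * b * t) / 2" using le G0 by simp
      also have "\<dots> \<le> a * \<delta> * T + G * exp (2 * b * t) / 2"
        using a \<delta> t by (intro add_mono mult_left_mono) auto
      finally show "signed_integral borel (\<lambda>A. \<rho> t A - \<sigma> t A) \<phi> \<le> a * T * \<delta> + G * exp (2 * b * t) / 2"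
        by (simp add: ac_simps)
    qed
  qed (use T in auto)
  then show ?thesis by (simp add: g_def a_def b_def ac_simps)
qed

theorem theorem4p1:
  fixes T M L\<^sub>\<Phi> C\<^sub>V L\<^sub>V L\<^sub>\<omega> C\<^sub>\<omega> :: real
    and \<Phi> :: "real \<Rightarrow> real \<Rightarrow> real \<Rightarrow> real"
    and \<mu> :: "(real^'n) measure"
    and \<rho>0 :: "(real^'n) set \<Rightarrow> real"
    and \<eta>0 :: "(real^'n) \<times> (real^'n) \<Rightarrow> real"
    and V \<omega> :: "real \<Rightarrow> ((real^'n) set \<Rightarrow> real) \<Rightarrow> (real^'n) \<times> (real^'n) \<Rightarrow> real"
    and \<epsilon> :: "nat \<Rightarrow> real"
    and \<rho> :: "nat \<Rightarrow> real \<Rightarrow> (real^'n) set \<Rightarrow> real"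
    and \<eta> :: "nat \<Rightarrow> real \<Rightarrow> (real^'n) \<times> (real^'n) \<Rightarrow> real"
    and \<rho>bar :: "real \<Rightarrow> (real^'n) set \<Rightarrow> real"
  assumes "T > 0" and "M > 0"
    and "admissible_interp L\<^sub>\<Phi> \<Phi>"
    and "radon_measure \<mu>"
    and "\<rho>0 \<in> M_TV_le M"
    and "\<eta>0 \<in> C_b_offdiag"
    and V_field: "\<forall>t\<in>{0..T}. \<forall>\<sigma>\<in>M_TV_le M.
          V t \<sigma> \<in> antisym_fields \<and> V t \<sigma> \<in> borel_measurable offdiag_borel"
    and "C\<^sub>V > 0" and "L\<^sub>V \<ge> 0"
    and V_bound: "(SUP t\<in>{0..T}. SUP \<sigma>\<in>M_TV_le M. SUP x.
          \<integral>\<^sup>+y\<in>UNIV - {x}. ennreal \<bar>V t \<sigma> (x, y)\<bar> \<partial>\<mu>) \<le> ennreal C\<^sub>V"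
    and V_lipschitz: "\<forall>t\<in>{0..T}. \<forall>\<sigma>\<in>M_TV_le M. \<forall>\<tau>\<in>M_TV_le M.
          (SUP x. \<integral>\<^sup>+y\<in>UNIV - {x}. ennreal \<bar>V t \<sigma> (x, y) - V t \<tau> (x, y)\<bar> \<partial>\<mu>)
            \<le> ennreal (L\<^sub>V * tv_norm (\<lambda>A. \<sigma> A - \<tau> A))"
    and \<omega>_continuous: "\<forall>t\<in>{0..T}. \<forall>\<sigma>\<in>M_TV_le M. continuous_on offdiag (\<omega> t \<sigma>)"
    and \<omega>_integrable: "\<forall>\<sigma>\<in>M_TV_le M. \<forall>z\<in>offdiag. set_integrable lebesgue {0..T} (\<lambda>t. \<omega> t \<sigma> z)"
    and "L\<^sub>\<omega> \<ge> 0" and "C\<^sub>\<omega> > 0"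
    and \<omega>_lipschitz: "\<forall>\<sigma>\<in>M_TV_le M. \<forall>\<tau>\<in>M_TV_le M. \<forall>t\<in>{0..T}. \<forall>z\<in>offdiag.
          \<bar>\<omega> t \<sigma> z - \<omega> t \<tau> z\<bar> \<le> L\<^sub>\<omega> * tv_norm (\<lambda>A. \<sigma> A - \<tau> A)"
    and \<omega>_bound: "\<forall>t\<in>{0..T}. \<forall>\<sigma>\<in>M_TV_le M. \<forall>z\<in>offdiag. \<bar>\<omega> t \<sigma> z\<bar> \<le> C\<^sub>\<omega>"
    and "\<forall>n. \<epsilon> n > 0" and "\<epsilon> \<longlonglongrightarrow> 0"
    and solutions: "\<forall>n. is_solution \<Phi> \<mu> V \<omega> (\<epsilon> n) T M (\<rho> n) (\<eta> n)
          \<and> \<rho> n 0 = \<rho>0 \<and> (\<forall>z\<in>offdiag. \<eta> n 0 z = \<eta>0 z)"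
    and limit: "is_frozen_solution \<Phi> \<mu> V T M \<eta>0 \<rho>0 \<rho>bar"
  shows "(\<lambda>n. d_infty T (\<rho> n, \<eta> n) (\<rho>bar, \<lambda>_. \<eta>0)) \<longlonglongrightarrow> 0"
proof -
  obtain E where E: "\<And>z. z \<in> offdiag \<Longrightarrow> \<bar>\<eta>0 z\<bar> \<le> E"
    using \<open>\<eta>0 \<in> C_b_offdiag\<close> by (force simp: C_b_offdiag_def bounded_iff)
  have E0: "E \<ge> 0" using offdiag_nonempty E by (meson abs_ge_zero ex_in_conv order_trans)
  \<comment> \<open>\<open>c * \<epsilon> n\<close> is the estimate of
    \<open>slow_variable_bound\<close> with \<open>A = C\<^sub>\<omega>\<close>, and
    \<open>k\<close> is the factor of \<open>\<delta>\<close> in \<open>transport_stability\<close>.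
    Neither constant depends on \<open>n\<close>.\<close>
  define c where "c = 2 * T * (C\<^sub>\<omega> + E)"
  define k where "k = 4 * L\<^sub>\<Phi> * C\<^sub>V * M * T * exp (4 * L\<^sub>\<Phi> * E * (C\<^sub>V + L\<^sub>V * M) * T)"
  have c0: "c \<ge> 0" using \<open>T > 0\<close> \<open>C\<^sub>\<omega> > 0\<close> E0 by (simp add: c_def)
  have k0: "k \<ge> 0"
    using \<open>T > 0\<close> \<open>M > 0\<close> \<open>C\<^sub>V > 0\<close> admissible_interp_pos[OF \<open>admissible_interp L\<^sub>\<Phi> \<Phi>\<close>] by (simp add: k_def)
  have Vb: "(\<integral>\<^sup>+y\<in>UNIV - {x}. ennreal \<bar>V t \<nu> (x, y)\<bar> \<partial>\<mu>) \<le> ennreal C\<^sub>V"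
    if "t \<in> {0..T}" "\<nu> \<in> M_TV_le M" for t \<nu> x
    using V_bound that unfolding SUP_le_iff by blast
  have Vl: "(\<integral>\<^sup>+y\<in>UNIV - {x}. ennreal \<bar>V t \<nu> (x, y) - V t \<tau> (x, y)\<bar> \<partial>\<mu>)
        \<le> ennreal (L\<^sub>V * tv_norm (\<lambda>A. \<nu> A - \<tau> A))"
    if "t \<in> {0..T}" "\<nu> \<in> M_TV_le M" "\<tau> \<in> M_TV_le M" for t \<nu> \<tau> x
    using V_lipschitz that unfolding SUP_le_iff by blast
  \<comment> \<open>The equation for the slow variable stands under the quantifier over test
    functions; the zero function is a witness that releases it.\<close>
  have zero: "(\<lambda>_. 0) \<in> (C_zero :: ((real^'n) \<Rightarrow> real) set)" by (simp add: C_zero_def)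
  note F = limit[unfolded is_frozen_solution_def]
  \<comment> \<open>\<open>small\<close> is what permits the absorption for the slow variable; it
    holds for all large \<open>n\<close>, which suffices for the limit.\<close>
  have bound: "d_infty T (\<rho> n, \<eta> n) (\<rho>bar, \<lambda>_. \<eta>0) \<le> ennreal ((k + 1) * c * \<epsilon> n)"
    if small: "\<epsilon> n * T \<le> 1 / 2" for n
  proof -
    have sol: "is_solution \<Phi> \<mu> V \<omega> (\<epsilon> n) T M (\<rho> n) (\<eta> n)" and \<rho>n0: "\<rho> n 0 = \<rho>0"
      and \<eta>n0: "\<And>z. z \<in> offdiag \<Longrightarrow> \<eta> n 0 z = \<eta>0 z"
      using solutions by blast+
    note S = sol[unfolded is_solution_def]
    have AC\<rho>: "AC_curve tv_norm (M_TV_le M) T (\<rho> n)" and AC\<eta>: "AC_curve sup_norm_offdiag C_b_offdiag T (\<eta> n)"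
      using S by blast+
    have \<rho>M: "\<rho> n t \<in> M_TV_le M" and \<eta>C: "\<eta> n t \<in> C_b_offdiag" if "t \<in> {0..T}" for t
      using AC\<rho> AC\<eta> that unfolding AC_curve_def by blast+
    have \<epsilon>n: "\<epsilon> n > 0" using \<open>\<forall>n. \<epsilon> n > 0\<close> by blast
    have \<eta>le: "\<bar>\<eta> n t z - \<eta>0 z\<bar> \<le> c * \<epsilon> n" if "t \<in> {0..T}" "z \<in> offdiag" for t z
    proof -
      have "AE t\<in>{0..T} in lebesgue. \<forall>z\<in>offdiag. \<eta> n t z = \<eta> n 0 z +
          \<epsilon> n * (LINT s:{0..t}|lebesgue. \<omega> s (\<rho> n s) z - \<eta> n s z)"
        using bspec[OF conjunct2[OF conjunct2[OF conjunct2[OF S]]] zero, THEN conjunct2]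
        by eventually_elim blast
      from slow_variable_bound[OF \<open>T > 0\<close> \<epsilon>n small AC\<eta> _ this _ _ that, of C\<^sub>\<omega> E]
      show ?thesis using S \<omega>_bound \<rho>M \<eta>n0 E that by (simp add: c_def)
    qed
    have c\<epsilon>: "c * \<epsilon> n \<ge> 0" using c0 \<epsilon>n by simp
    have \<rho>le: "tv_norm (\<lambda>A. \<rho> n t A - \<rho>bar t A) \<le> k * (c * \<epsilon> n)" if t: "t \<in> {0..T}" for t
      unfolding k_def
    proof (rule transport_stability[where V=V and \<Phi>=\<Phi> and \<mu>=\<mu> and \<eta>="\<eta> n" and \<theta>=\<eta>0])
      show "AC_curve tv_norm (M_TV_le M) T \<rho>bar" using F by blast
      show "\<rho> n 0 = \<rho>bar 0" using F \<rho>n0 by simp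
      fix \<phi> :: "real^'n \<Rightarrow> real" assume \<phi>: "\<phi> \<in> C_zero"
      show "set_integrable lebesgue {0..T} (\<lambda>t. nl_div_pairing \<phi> (flux \<Phi> \<mu> (\<eta> n t) (\<rho> n t) (V t (\<rho> n t))))"
        using S \<phi> by blast
      show "set_integrable lebesgue {0..T} (\<lambda>t. nl_div_pairing \<phi> (flux \<Phi> \<mu> \<eta>0 (\<rho>bar t) (V t (\<rho>bar t))))"
        using F \<phi> by blast
      show "AE t\<in>{0..T} in lebesgue. signed_integral borel (\<rho> n t) \<phi> = signed_integral borel (\<rho> n 0) \<phi>
          + 1/2 * (LINT s:{0..t}|lebesgue.
            signed_integral offdiag_borel (flux \<Phi> \<mu> (\<eta> n s) (\<rho> n s) (V s (\<rho> n s))) (nl_grad \<phi>))"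
        using bspec[OF conjunct2[OF conjunct2[OF conjunct2[OF S]]] \<phi>, THEN conjunct2]
        by eventually_elim blast
      show "AE t\<in>{0..T} in lebesgue. signed_integral borel (\<rho>bar t) \<phi> = signed_integral borel (\<rho>bar 0) \<phi>
          + 1/2 * (LINT s:{0..t}|lebesgue.
            signed_integral offdiag_borel (flux \<Phi> \<mu> \<eta>0 (\<rho>bar s) (V s (\<rho>bar s))) (nl_grad \<phi>))"
        using bspec[OF conjunct2[OF conjunct2[OF F]] \<phi>, THEN conjunct2] conjunct1[OF conjunct2[OF F]] by simp
    qed (use assms(1-10) Vb Vl E E0 \<eta>le c\<epsilon> AC\<rho> \<eta>C t in auto)
    have "d_infty T (\<rho> n, \<eta> n) (\<rho>bar, \<lambda>_. \<eta>0) \<le> ennreal (k * (c * \<epsilon> n)) + ennreal (c * \<epsilon> n)"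
      unfolding d_infty_def prod.case
      by (intro add_mono SUP_least ennreal_leI \<rho>le sup_norm_offdiag_le \<eta>le)
    \<comment> \<open>Both summands must be nonnegative for \<open>ennreal\<close> to be additive;
      \<open>k * c\<close> comes from the densities and \<open>c\<close> from the slow
      variable.\<close>
    also have "\<dots> = ennreal ((k + 1) * c * \<epsilon> n)"
      using mult_nonneg_nonneg[OF k0 c\<epsilon>] c\<epsilon> by (subst ennreal_plus[symmetric]) (auto simp: algebra_simps)
    finally show ?thesis .
  qed
  have "(\<lambda>n. \<epsilon> n * T) \<longlonglongrightarrow> 0 * T" using \<open>\<epsilon> \<longlonglongrightarrow> 0\<close> by (intro tendsto_intros)
  then have "eventually (\<lambda>n. \<epsilon> n * T < 1 / 2) sequentially" by (intro order_tendstoD(2)) auto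
  then have ev: "eventually (\<lambda>n. d_infty T (\<rho> n, \<eta> n) (\<rho>bar, \<lambda>_. \<eta>0) \<le> ennreal ((k + 1) * c * \<epsilon> n)) sequentially"
    by eventually_elim (simp add: bound)
  have "(\<lambda>n. (k + 1) * c * \<epsilon> n) \<longlonglongrightarrow> (k + 1) * c * 0" using \<open>\<epsilon> \<longlonglongrightarrow> 0\<close> by (intro tendsto_intros)
  then have lim: "(\<lambda>n. ennreal ((k + 1) * c * \<epsilon> n)) \<longlonglongrightarrow> 0"
    using tendsto_ennrealI by fastforce
  show ?thesis
    by (rule tendsto_sandwich[OF _ ev tendsto_const lim]) simp
qed

end
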